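(* Let $X$ be a distance-regular graph of diameter $d>1$ with valency $k$, intersection parameters $b_i,c_i$ and least eigenvalue $\theta_d$, and suppose that the core $X^{\bullet}$ of $X$ is a complete graph. Then $\theta_d\le -2$. Further, if $\theta_d=-2$, then for every edge $uv$ of $X$ and every homomorphism $\phi$ from $X$ to $X^{\bullet}$, at most one neighbour $w\neq u$ of $v$ satisfies $\phi(w)=\phi(u)$; and thus for any (proper) colouring $f$ of $X$ and any $x\in V(X)$, writing $f(x)=c$, $$|\{y\in f^{-1}(c)\mid d(x,y)=2\}|\le \frac{k}{c_2}.$$
   Context: Graphs are finite and simple. A connected graph $X$ of diameter $d$ is distance-regular if there are numbers $b_i,c_i$ such that for any two vertices $u,v$ at distance $i$, exactly $c_i$ neighbours of $v$ are at distance $i-1$ from $u$ and exactly $b_i$ neighbours of $v$ are at distance $i+1$ from $u$; the valency is $k=b_0$. Such a graph has exactly $d+1$ distinct adjacency eigenvalues $\theta_0>\theta_1>\cdots>\theta_d$. $d(x,y)$ denotes distance in $X$. A homomorphism is a vertex map sending adjacent vertices to adjacent vertices. A graph is a core if each of its endomorphisms (homomorphisms to itself) is an automorphism; the core $X^{\bullet}$ of $X$ is a subgraph of $X$ which is a core and to which $X$ has a homomorphism. It is unique up to isomorphism and is an induced subgraph of $X$. *)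

theory Defs
  imports Complex_Main "Graph_Theory.Graph_Theory"
begin

text \<open>
  A finite simple graph is a \<^locale>\<open>pair_graph\<close>: finitely many vertices and a symmetric,
  loopfree set of arcs. An undirected edge \<open>uv\<close> is thus present as both \<open>(u, v)\<close> and \<open>(v, u)\<close>.
\<close>

definition neighbours :: "'a pair_pre_digraph \<Rightarrow> 'a \<Rightarrow> 'a set" where
  "neighbours X v = {w. (v, w) \<in> parcs X}"

text \<open>Only meaningful if some walk joins \<open>u\<close> and \<open>v\<close>; it is used for connected graphs only.\<close>

definition graph_dist :: "'a pair_pre_digraph \<Rightarrow> 'a \<Rightarrow> 'a \<Rightarrow> nat" where
  "graph_dist X u v = (LEAST n. \<exists>p. pre_digraph.awalk (with_proj X) u p v \<and> length p = n)"

definition graph_diameter :: "'a pair_pre_digraph \<Rightarrow> nat" where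
  "graph_diameter X = Max {graph_dist X u v | u v. u \<in> pverts X \<and> v \<in> pverts X}"

text \<open>
  The condition on \<open>c\<close> is phrased with \<open>+ 1\<close> on the left so that no truncated subtraction
  occurs; for \<open>u = v\<close> it says \<open>c 0 = 0\<close>. The values of \<open>b\<close> and \<open>c\<close> beyond the diameter are
  irrelevant. The library's \<open>connected\<close> includes that there is at least one vertex.
\<close>

definition distance_regular ::
    "'a pair_pre_digraph \<Rightarrow> (nat \<Rightarrow> nat) \<Rightarrow> (nat \<Rightarrow> nat) \<Rightarrow> bool" where
  "distance_regular X b c \<longleftrightarrow>
     pair_graph X \<and> connected (with_proj X) \<and>
     (\<forall>u \<in> pverts X. \<forall>v \<in> pverts X.
        card {w \<in> neighbours X v. graph_dist X u w + 1 = graph_dist X u v}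
          = c (graph_dist X u v) \<and>
        card {w \<in> neighbours X v. graph_dist X u w = graph_dist X u v + 1}
          = b (graph_dist X u v))"

definition adjacency_matrix :: "'a pair_pre_digraph \<Rightarrow> 'a \<Rightarrow> 'a \<Rightarrow> real" where
  "adjacency_matrix X u v = (if (u, v) \<in> parcs X then 1 else 0)"

text \<open>
  The adjacency matrix is indexed by the vertices themselves, so a vector is a function of which
  only the values on \<^term>\<open>pverts X\<close> matter. As the matrix is real symmetric, considering
  real eigenvalues loses nothing, and there are finitely many and at least one of them, so the
  minimum below is attained.
\<close>

definition graph_eigenvalues :: "'a pair_pre_digraph \<Rightarrow> real set" where
  "graph_eigenvalues X =
     {\<theta>. \<exists>x :: 'a \<Rightarrow> real. (\<exists>v \<in> pverts X. x v \<noteq> 0) \<and>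
        (\<forall>u \<in> pverts X. (\<Sum>v \<in> pverts X. adjacency_matrix X u v * x v) = \<theta> * x u)}"

definition least_graph_eigenvalue :: "'a pair_pre_digraph \<Rightarrow> real" where
  "least_graph_eigenvalue X = Min (graph_eigenvalues X)"

definition graph_hom :: "'a pair_pre_digraph \<Rightarrow> 'b pair_pre_digraph \<Rightarrow> ('a \<Rightarrow> 'b) \<Rightarrow> bool" where
  "graph_hom X Y \<phi> \<longleftrightarrow>
     \<phi> ` pverts X \<subseteq> pverts Y \<and> (\<forall>u v. (u, v) \<in> parcs X \<longrightarrow> (\<phi> u, \<phi> v) \<in> parcs Y)"

definition graph_aut :: "'a pair_pre_digraph \<Rightarrow> ('a \<Rightarrow> 'a) \<Rightarrow> bool" where
  "graph_aut X \<phi> \<longleftrightarrow>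
     bij_betw \<phi> (pverts X) (pverts X) \<and>
     (\<forall>u \<in> pverts X. \<forall>v \<in> pverts X. (\<phi> u, \<phi> v) \<in> parcs X \<longleftrightarrow> (u, v) \<in> parcs X)"

definition is_graph_core :: "'a pair_pre_digraph \<Rightarrow> bool" where
  "is_graph_core X \<longleftrightarrow> pair_graph X \<and> (\<forall>\<phi>. graph_hom X X \<phi> \<longrightarrow> graph_aut X \<phi>)"

text \<open>
  Since the core of a graph is unique only up to isomorphism, being a core of \<open>X\<close> is a relation.
\<close>

definition is_core_of :: "'a pair_pre_digraph \<Rightarrow> 'a pair_pre_digraph \<Rightarrow> bool" where
  "is_core_of Y X \<longleftrightarrow>
     subgraph (with_proj Y) (with_proj X) \<and> is_graph_core Y \<and> (\<exists>\<phi>. graph_hom X Y \<phi>)"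

definition is_complete_graph :: "'a pair_pre_digraph \<Rightarrow> bool" where
  "is_complete_graph Y \<longleftrightarrow> (\<exists>n. complete_digraph n (with_proj Y))"

definition proper_colouring :: "'a pair_pre_digraph \<Rightarrow> ('a \<Rightarrow> 'c) \<Rightarrow> bool" where
  "proper_colouring X f \<longleftrightarrow> (\<forall>u v. (u, v) \<in> parcs X \<longrightarrow> f u \<noteq> f v)"

end

theory Submission
  imports Defs "HOL-Analysis.Function_Topology"
begin

text \<open>
  Let \<open>\<theta>\<close> be the least eigenvalue, \<open>k\<close> the valency and \<open>n\<close> the order of the complete core. The
  graph contains a clique with \<open>n\<close> vertices and has a proper colouring with \<open>n\<close> colours. The first
  fact bounds \<open>n\<close> from above by \<open>1 - k / \<theta>\<close> (Delsarte's clique bound, \<open>clique_bound\<close>) and the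
  second bounds it from below by the same number (Hoffman's bound, \<open>colouring_bound\<close>). Hence
  \<open>k = -\<theta> (n - 1)\<close>, and both bounds are tight for every clique of order \<open>n\<close>.

  Tightness of the clique bound for a clique \<open>Q\<close> says that the projection of its characteristic
  vector to the \<open>\<theta>\<close>-eigenspace vanishes. Evaluated at a vertex \<open>t\<close> outside \<open>Q\<close> with a neighbour
  in \<open>Q\<close>, whose distances to \<open>Q\<close> are 1 and 2 only, this determines the number of neighbours of
  \<open>t\<close> in \<open>Q\<close>: it is a constant \<open>m\<close> (\<open>tight_clique_outside_degree\<close>), and \<open>m < n\<close> because the
  colouring excludes larger cliques.

  Everything else is counting inside the neighbourhood of a vertex \<open>u\<close> of \<open>Q\<close>
  (\<open>tight_clique_neighbourhood\<close>). It consists of \<open>Q - {u}\<close> and the set \<open>L\<close> of the \<open>k - (n - 1)\<close>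
  neighbours outside \<open>Q\<close>, and every vertex of it has exactly \<open>b\<^sub>1\<close> non-neighbours in it. A vertex
  of \<open>L\<close> has \<open>n - m > 0\<close> of them in \<open>Q\<close>, so \<open>n - m \<le> b\<^sub>1\<close>; counting non-adjacent pairs
  between \<open>Q - {u}\<close> and \<open>L\<close> gives \<open>(n - 1) b\<^sub>1 = |L| (n - m)\<close>. Therefore \<open>|L| \<ge> n - 1\<close>, that is,
  \<open>k \<ge> 2 (n - 1)\<close> and \<open>\<theta> \<le> -2\<close>. If \<open>\<theta> = -2\<close>, then \<open>n - m = b\<^sub>1\<close>, which leaves no non-adjacent
  pair in \<open>L\<close>: the neighbourhood of \<open>u\<close> is a union of two cliques, and \<open>L\<close> together with \<open>u\<close> is again
  a clique of order \<open>n\<close>. By connectedness this spreads to all vertices, so the graph contains no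
  induced claw: at most two vertices of a colour class, for whatever proper colouring, are adjacent
  to a given vertex. This is the statement about homomorphisms to the core, and counting the
  paths of length two that start at \<open>x\<close> and return to its colour class gives the last bound.
\<close>

section \<open>Symmetric real matrices\<close>

definition eigenvector_on :: "'a set \<Rightarrow> ('a \<Rightarrow> 'a \<Rightarrow> real) \<Rightarrow> real \<Rightarrow> ('a \<Rightarrow> real) \<Rightarrow> bool" where
  "eigenvector_on S A \<theta> x \<longleftrightarrow> (\<forall>u\<in>S. (\<Sum>v\<in>S. A u v * x v) = \<theta> * x u)"

definition quadratic_form :: "'a set \<Rightarrow> ('a \<Rightarrow> 'a \<Rightarrow> real) \<Rightarrow> ('a \<Rightarrow> real) \<Rightarrow> real" where
  "quadratic_form S A x = (\<Sum>u\<in>S. x u * (\<Sum>v\<in>S. A u v * x v))"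

definition norm_sq_on :: "'a set \<Rightarrow> ('a \<Rightarrow> real) \<Rightarrow> real" where
  "norm_sq_on S x = (\<Sum>u\<in>S. (x u)\<^sup>2)"

lemma quadratic_form_eigenvector:
  "eigenvector_on S A \<theta> x \<Longrightarrow> quadratic_form S A x = \<theta> * norm_sq_on S x"
  by (simp add: eigenvector_on_def quadratic_form_def norm_sq_on_def sum_distrib_left
      power2_eq_square mult.left_commute)

lemma norm_sq_on_pos:
  assumes "finite S" "u \<in> S" "x u \<noteq> 0"
  shows "norm_sq_on S x > 0"
  unfolding norm_sq_on_def using assms by (intro sum_pos2[of _ u]) auto

lemma norm_sq_on_scale: "norm_sq_on S (\<lambda>u. t * x u) = t\<^sup>2 * norm_sq_on S x"
  by (simp add: norm_sq_on_def power_mult_distrib sum_distrib_left)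

lemma quadratic_form_scale: "quadratic_form S A (\<lambda>u. t * x u) = t\<^sup>2 * quadratic_form S A x"
proof -
  have "(\<Sum>v\<in>S. A u v * (t * x v)) = t * (\<Sum>v\<in>S. A u v * x v)" for u
    by (simp add: sum_distrib_left mult.left_commute)
  then show ?thesis
    by (simp add: quadratic_form_def sum_distrib_left power2_eq_square mult_ac)
qed

lemma symmetric_bilinear:
  fixes A :: "'a \<Rightarrow> 'a \<Rightarrow> real"
  assumes "\<And>u v. u \<in> S \<Longrightarrow> v \<in> S \<Longrightarrow> A u v = A v u"
  shows "(\<Sum>u\<in>S. x u * (\<Sum>v\<in>S. A u v * y v)) = (\<Sum>u\<in>S. y u * (\<Sum>v\<in>S. A u v * x v))"
proof -
  have "(\<Sum>u\<in>S. x u * (\<Sum>v\<in>S. A u v * y v)) = (\<Sum>u\<in>S. \<Sum>v\<in>S. x u * (A u v * y v))"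
    by (simp only: sum_distrib_left)
  also have "\<dots> = (\<Sum>v\<in>S. \<Sum>u\<in>S. x u * (A u v * y v))" by (rule sum.swap)
  also have "\<dots> = (\<Sum>v\<in>S. y v * (\<Sum>u\<in>S. A v u * x u))"
    using assms by (auto simp: sum_distrib_left mult_ac intro!: sum.cong)
  finally show ?thesis .
qed

lemma quadratic_form_add:
  assumes "\<And>u v. u \<in> S \<Longrightarrow> v \<in> S \<Longrightarrow> A u v = A v u"
  shows "quadratic_form S A (\<lambda>u. x u + t * z u) =
    quadratic_form S A x + 2 * t * (\<Sum>u\<in>S. z u * (\<Sum>v\<in>S. A u v * x v)) + t\<^sup>2 * quadratic_form S A z"
proof -
  have e: "(\<Sum>v\<in>S. A u v * (x v + t * z v)) = (\<Sum>v\<in>S. A u v * x v) + t * (\<Sum>v\<in>S. A u v * z v)" for u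
    by (simp add: sum.distrib sum_distrib_left algebra_simps)
  have "quadratic_form S A (\<lambda>u. x u + t * z u) = quadratic_form S A x
     + t * (\<Sum>u\<in>S. x u * (\<Sum>v\<in>S. A u v * z v)) + t * (\<Sum>u\<in>S. z u * (\<Sum>v\<in>S. A u v * x v))
     + t\<^sup>2 * quadratic_form S A z"
    unfolding quadratic_form_def e
    by (simp add: algebra_simps sum.distrib sum_distrib_left power2_eq_square)
  then show ?thesis using symmetric_bilinear[where S = S and x = x and y = z, OF assms] by (simp add: algebra_simps)
qed

text \<open>
  Moving from \<open>x\<close> in the direction of the defect \<open>z = A x - \<theta> x\<close> changes the non-negative function
  \<open>quadratic_form - \<theta> norm_sq_on\<close> by \<open>2 t |z|\<^sup>2 + O(t\<^sup>2)\<close> from its value 0. A small negative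
  \<open>t\<close> would make it negative unless \<open>z = 0\<close>.
\<close>

lemma rayleigh_minimiser_eigenvector:
  assumes sym: "\<And>u v. u \<in> S \<Longrightarrow> v \<in> S \<Longrightarrow> A u v = A v u" and fin: "finite S"
    and lower: "\<And>y. \<theta> * norm_sq_on S y \<le> quadratic_form S A y"
    and tight: "quadratic_form S A x = \<theta> * norm_sq_on S x"
  shows "eigenvector_on S A \<theta> x"
proof -
  define z where "z u = (\<Sum>v\<in>S. A u v * x v) - \<theta> * x u" for u
  define R where "R = quadratic_form S A z - \<theta> * norm_sq_on S z"
  define Z where "Z = norm_sq_on S z"
  have Zx: "(\<Sum>u\<in>S. z u * (\<Sum>v\<in>S. A u v * x v)) - \<theta> * (\<Sum>u\<in>S. z u * x u) = Z"
  proof -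
    have "z u * a - \<theta> * (z u * x u) = z u * (a - \<theta> * x u)" for u a by (simp add: algebra_simps)
    then show ?thesis
      unfolding Z_def norm_sq_on_def sum_distrib_left[of \<theta>] sum_subtractf[symmetric]
      by (simp add: z_def[symmetric] power2_eq_square)
  qed
  have nadd: "norm_sq_on S (\<lambda>u. x u + t * z u)
      = norm_sq_on S x + 2 * t * (\<Sum>u\<in>S. z u * x u) + t\<^sup>2 * Z" for t
    unfolding norm_sq_on_def Z_def
    by (simp add: power2_eq_square algebra_simps sum.distrib sum_distrib_left)
  have qadd: "quadratic_form S A (\<lambda>u. x u + t * z u) = quadratic_form S A x
      + 2 * t * (\<Sum>u\<in>S. z u * (\<Sum>v\<in>S. A u v * x v)) + t\<^sup>2 * quadratic_form S A z" for t
    by (rule quadratic_form_add) (rule sym)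
  have quad: "2 * t * Z + t\<^sup>2 * R \<ge> 0" for t
  proof -
    have "0 \<le> quadratic_form S A (\<lambda>u. x u + t * z u) - \<theta> * norm_sq_on S (\<lambda>u. x u + t * z u)"
      using lower by simp
    also have "\<dots> = 2 * t * ((\<Sum>u\<in>S. z u * (\<Sum>v\<in>S. A u v * x v)) - \<theta> * (\<Sum>u\<in>S. z u * x u)) + t\<^sup>2 * R"
      unfolding qadd nadd tight R_def Z_def[symmetric] by (simp only: algebra_simps)
    finally show ?thesis by (simp only: Zx)
  qed
  have "Z \<ge> 0" by (simp add: Z_def norm_sq_on_def sum_nonneg)
  have "Z = 0"
  proof (rule ccontr)
    assume "Z \<noteq> 0"
    with \<open>Z \<ge> 0\<close> have "Z > 0" by simp
    (* With |t R| <= Z the linear term 2 t Z outweighs the quadratic one. *)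
    define t where "t = - Z / (\<bar>R\<bar> + 1)"
    have t: "t < 0" "t * (\<bar>R\<bar> + 1) = - Z" using \<open>Z > 0\<close> by (auto simp: t_def)
    have "\<bar>t * R\<bar> \<le> Z"
      using t by (simp add: abs_mult algebra_simps)
    then have "2 * Z + t * R > 0" using \<open>Z > 0\<close> by linarith
    with \<open>t < 0\<close> have "t * (2 * Z + t * R) < 0" by (simp add: mult_neg_pos)
    with quad[of t] show False by (simp add: algebra_simps power2_eq_square)
  qed
  then have "\<forall>u\<in>S. z u = 0"
    using fin by (auto simp: Z_def norm_sq_on_def sum_nonneg_eq_0_iff)
  then show ?thesis by (simp add: eigenvector_on_def z_def)
qed

text \<open>
  The quadratic form is a continuous function on the unit sphere. Functions on the whole type carry
  the product topology, so the sphere becomes compact once its elements are required to vanish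
  outside \<open>S\<close>; neither the form nor the norm sees those values.
\<close>

lemma rayleigh_minimum_attained:
  assumes fin: "finite S" and ne: "S \<noteq> {}"
  obtains x where "norm_sq_on S x = 1"
    and "\<And>y. quadratic_form S A x * norm_sq_on S y \<le> quadratic_form S A y"
proof -
  let ?box = "Pi\<^sub>E UNIV (\<lambda>u. if u \<in> S then {-1..1::real} else {0})"
  let ?K = "?box \<inter> {x. norm_sq_on S x = 1}"
  have coord: "continuous_on UNIV (\<lambda>x::'a \<Rightarrow> real. x u)" for u
    by (rule continuous_on_product_coordinates)
  have contN: "continuous_on UNIV (norm_sq_on S)"
    unfolding norm_sq_on_def by (intro continuous_intros coord)
  have contQ: "continuous_on UNIV (quadratic_form S A)"
    unfolding quadratic_form_def by (intro continuous_intros coord)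
  have "compactin (product_topology (\<lambda>u. euclidean) UNIV) ?box"
    by (subst compactin_PiE) auto
  then have "compact ?box" by (simp add: euclidean_product_topology)
  moreover have "closed {x. norm_sq_on S x = 1}"
    by (intro closed_Collect_eq contN continuous_on_const)
  ultimately have comp: "compact ?K" by (rule compact_Int_closed)
  have inK: "\<exists>x'\<in>?K. quadratic_form S A x' = quadratic_form S A x" if x: "norm_sq_on S x = 1" for x
  proof (intro bexI[of _ "\<lambda>u. if u \<in> S then x u else 0"])
    have "x u \<in> {-1..1}" if "u \<in> S" for u
    proof -
      have "(x u)\<^sup>2 \<le> 1" using x member_le_sum[OF that, of "\<lambda>u. (x u)\<^sup>2"] fin
        by (simp add: norm_sq_on_def)
      then show ?thesis by (auto simp: abs_square_le_1 abs_le_iff)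
    qed
    then show "(\<lambda>u. if u \<in> S then x u else 0) \<in> ?K"
      using x by (auto simp: norm_sq_on_def)
    show "quadratic_form S A (\<lambda>u. if u \<in> S then x u else 0) = quadratic_form S A x"
      by (simp add: quadratic_form_def)
  qed
  obtain s where "s \<in> S" using ne by auto
  then have "norm_sq_on S (\<lambda>u. if u = s then 1 else 0) = 1"
    using fin by (simp add: norm_sq_on_def if_distrib[of "\<lambda>r. r\<^sup>2"] cong: if_cong)
  from inK[OF this] have "?K \<noteq> {}" by blast
  from continuous_attains_inf[OF comp this continuous_on_subset[OF contQ subset_UNIV]]
  obtain x where x: "x \<in> ?K" and min: "\<And>y. y \<in> ?K \<Longrightarrow> quadratic_form S A x \<le> quadratic_form S A y"
    by blast
  show ?thesis
  proof (rule that[of x])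
    show "norm_sq_on S x = 1" using x by simp
    show "quadratic_form S A x * norm_sq_on S y \<le> quadratic_form S A y" for y
    proof (cases "norm_sq_on S y = 0")
      case True
      then have "y u = 0" if "u \<in> S" for u
        using that fin norm_sq_on_pos[of S u y] by fastforce
      then show ?thesis using True by (simp add: quadratic_form_def)
    next
      case False
      then have pos: "norm_sq_on S y > 0"
        by (simp add: less_le norm_sq_on_def sum_nonneg)
      define t where "t = 1 / sqrt (norm_sq_on S y)"
      have t: "t\<^sup>2 = 1 / norm_sq_on S y" using pos by (simp add: t_def power_divide)
      have "norm_sq_on S (\<lambda>u. t * y u) = 1" using pos by (simp add: norm_sq_on_scale t)
      from inK[OF this] min have "quadratic_form S A x \<le> t\<^sup>2 * quadratic_form S A y"
        by (metis quadratic_form_scale)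
      then show ?thesis using pos by (simp add: t field_simps)
    qed
  qed
qed

lemma eigenvectors_orthogonal:
  assumes sym: "\<And>u v. u \<in> S \<Longrightarrow> v \<in> S \<Longrightarrow> A u v = A v u"
    and "eigenvector_on S A \<theta> x" "eigenvector_on S A \<eta> y" "\<theta> \<noteq> \<eta>"
  shows "(\<Sum>u\<in>S. x u * y u) = 0"
proof -
  have "\<eta> * (\<Sum>u\<in>S. x u * y u) = (\<Sum>u\<in>S. x u * (\<Sum>v\<in>S. A u v * y v))"
    using assms(3) by (simp add: eigenvector_on_def sum_distrib_left mult.left_commute)
  also have "\<dots> = (\<Sum>u\<in>S. y u * (\<Sum>v\<in>S. A u v * x v))"
    by (rule symmetric_bilinear[OF sym])
  also have "\<dots> = \<theta> * (\<Sum>u\<in>S. x u * y u)"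
    using assms(2) by (simp add: eigenvector_on_def sum_distrib_left mult_ac)
  finally show ?thesis using \<open>\<theta> \<noteq> \<eta>\<close> by simp
qed

text \<open>
  By Bessel's inequality for the unit vector at \<open>v\<close>, the squares of the coordinates of the vectors
  \<open>e i\<close> at \<open>v\<close> sum to at most 1. Summing over \<open>v\<close> counts the vectors, since each has norm 1.
\<close>

lemma orthonormal_card_le:
  assumes fin: "finite S" "finite I"
    and on: "\<And>i j. i \<in> I \<Longrightarrow> j \<in> I \<Longrightarrow> (\<Sum>u\<in>S. e i u * e j u) = (if i = j then 1 else 0 :: real)"
  shows "card I \<le> card S"
proof -
  have bessel: "(\<Sum>i\<in>I. (e i v)\<^sup>2) \<le> 1" if v: "v \<in> S" for v
  proof -
    (* The orthogonal projection of the unit vector at v to the span of the vectors e i. *)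
    define p where "p u = (\<Sum>i\<in>I. e i v * e i u)" for u
    define B where "B = (\<Sum>i\<in>I. (e i v)\<^sup>2)"
    have "p v = B" by (simp add: p_def B_def power2_eq_square)
    have "(\<Sum>u\<in>S. (p u)\<^sup>2) = (\<Sum>u\<in>S. \<Sum>i\<in>I. \<Sum>j\<in>I. e i v * e j v * (e i u * e j u))"
      unfolding p_def power2_eq_square sum_product by (simp add: mult_ac)
    also have "\<dots> = (\<Sum>i\<in>I. \<Sum>u\<in>S. \<Sum>j\<in>I. e i v * e j v * (e i u * e j u))" by (rule sum.swap)
    also have "\<dots> = (\<Sum>i\<in>I. \<Sum>j\<in>I. \<Sum>u\<in>S. e i v * e j v * (e i u * e j u))"
      by (intro sum.cong refl sum.swap)
    also have "\<dots> = (\<Sum>i\<in>I. \<Sum>j\<in>I. e i v * e j v * (if i = j then 1 else 0))"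
      by (intro sum.cong refl) (simp add: sum_distrib_left[symmetric] on)
    also have "\<dots> = B" using fin by (simp add: B_def power2_eq_square if_distrib cong: if_cong)
    finally have pp: "(\<Sum>u\<in>S. (p u)\<^sup>2) = B" .
    have "0 \<le> (\<Sum>u\<in>S. ((if u = v then 1 else 0) - p u)\<^sup>2)" by (simp add: sum_nonneg)
    also have "\<dots> = (\<Sum>u\<in>S. (if u = v then 1 - 2 * p u else 0) + (p u)\<^sup>2)"
      by (intro sum.cong) (auto simp: power2_eq_square algebra_simps)
    also have "\<dots> = 1 - 2 * p v + B" using fin v by (simp add: sum.distrib pp)
    finally show ?thesis using \<open>p v = B\<close> by (simp add: B_def)
  qed
  have "real (card I) = (\<Sum>i\<in>I. \<Sum>v\<in>S. (e i v)\<^sup>2)"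
    using on by (simp add: power2_eq_square)
  also have "\<dots> = (\<Sum>v\<in>S. \<Sum>i\<in>I. (e i v)\<^sup>2)" by (rule sum.swap)
  also have "\<dots> \<le> (\<Sum>v\<in>S. 1)" by (intro sum_mono bessel)
  finally show ?thesis by simp
qed

text \<open>
  Eigenvectors for distinct eigenvalues are orthogonal, so there are at most as many eigenvalues as
  coordinates. Finiteness is what gives \<^const>\<open>Min\<close> its meaning in the definition of the least
  eigenvalue.
\<close>

lemma finite_eigenvalues:
  assumes fin: "finite S" and sym: "\<And>u v. u \<in> S \<Longrightarrow> v \<in> S \<Longrightarrow> A u v = A v u"
  shows "finite {\<theta>. \<exists>x. (\<exists>v\<in>S. x v \<noteq> 0) \<and> eigenvector_on S A \<theta> x}" (is "finite ?E")
proof (rule ccontr)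
  assume "infinite ?E"
  then obtain I where I: "I \<subseteq> ?E" "finite I" "card I = Suc (card S)"
    by (meson infinite_arbitrarily_large)
  then have "\<forall>\<theta>\<in>I. \<exists>x. (\<exists>v\<in>S. x v \<noteq> 0) \<and> eigenvector_on S A \<theta> x" by auto
  then obtain x where x: "\<And>\<theta>. \<theta> \<in> I \<Longrightarrow> (\<exists>v\<in>S. x \<theta> v \<noteq> 0) \<and> eigenvector_on S A \<theta> (x \<theta>)"
    by metis
  define e where "e \<theta> u = x \<theta> u / sqrt (norm_sq_on S (x \<theta>))" for \<theta> u
  have "(\<Sum>u\<in>S. e i u * e j u) = (if i = j then 1 else 0)" if "i \<in> I" "j \<in> I" for i j
  proof -
    have "(\<Sum>u\<in>S. e i u * e j u)
        = (\<Sum>u\<in>S. x i u * x j u) / (sqrt (norm_sq_on S (x i)) * sqrt (norm_sq_on S (x j)))"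
      by (simp add: e_def sum_divide_distrib)
    moreover have "norm_sq_on S (x i) > 0" using x[OF that(1)] norm_sq_on_pos[OF fin] by blast
    ultimately show ?thesis
      using eigenvectors_orthogonal[where S = S and x = "x i" and y = "x j", OF sym] x[OF that(1)] x[OF that(2)]
      by (auto simp: norm_sq_on_def power2_eq_square)
  qed
  from orthonormal_card_le[OF fin I(2) this] I(3) show False by simp
qed


text \<open>
  The minimum of the Rayleigh quotient is an eigenvalue, and no eigenvalue lies below it because
  the quotient of an eigenvector is its eigenvalue.
\<close>

lemma least_graph_eigenvalue_rayleigh:
  assumes "pair_graph G" "pverts G \<noteq> {}"
  shows "\<exists>x. (\<exists>v\<in>pverts G. x v \<noteq> 0) \<and>
      eigenvector_on (pverts G) (adjacency_matrix G) (least_graph_eigenvalue G) x"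
    and "least_graph_eigenvalue G * norm_sq_on (pverts G) y
      \<le> quadratic_form (pverts G) (adjacency_matrix G) y"
proof -
  interpret pair_graph G by fact
  let ?S = "pverts G" and ?A = "adjacency_matrix G" and ?E = "graph_eigenvalues G"
  have fin: "finite ?S" by (rule pair_finite_verts)
  have sym: "?A u v = ?A v u" for u v
    by (auto simp: adjacency_matrix_def dest: arcs_symmetric)
  have E: "?E = {\<theta>. \<exists>x. (\<exists>v\<in>?S. x v \<noteq> 0) \<and> eigenvector_on ?S ?A \<theta> x}"
    by (simp add: graph_eigenvalues_def eigenvector_on_def)
  have finE: "finite ?E" unfolding E by (rule finite_eigenvalues) (use fin sym in auto)
  obtain x where x: "norm_sq_on ?S x = 1"
    and lower: "\<And>y. quadratic_form ?S ?A x * norm_sq_on ?S y \<le> quadratic_form ?S ?A y"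
    using rayleigh_minimum_attained[OF fin assms(2)] by blast
  let ?\<mu> = "quadratic_form ?S ?A x"
  have eig: "eigenvector_on ?S ?A ?\<mu> x"
    by (rule rayleigh_minimiser_eigenvector) (use sym fin lower x in auto)
  moreover have "\<exists>v\<in>?S. x v \<noteq> 0" using x by (auto simp: norm_sq_on_def intro: ccontr)
  ultimately have mem: "?\<mu> \<in> ?E" unfolding E by blast
  have "?\<mu> \<le> \<eta>" if \<eta>: "\<eta> \<in> ?E" for \<eta>
  proof -
    obtain y v where y: "v \<in> ?S" "y v \<noteq> 0" "eigenvector_on ?S ?A \<eta> y" using \<eta> unfolding E by blast
    then have "norm_sq_on ?S y > 0" by (intro norm_sq_on_pos[OF fin])
    with lower[of y] show ?thesis by (simp add: quadratic_form_eigenvector[OF y(3)])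
  qed
  with mem finE have least: "least_graph_eigenvalue G = ?\<mu>"
    unfolding least_graph_eigenvalue_def by (intro Min_eqI)
  show "\<exists>x. (\<exists>v\<in>?S. x v \<noteq> 0) \<and> eigenvector_on ?S ?A (least_graph_eigenvalue G) x"
    using mem unfolding E least by blast
  show "least_graph_eigenvalue G * norm_sq_on ?S y \<le> quadratic_form ?S ?A y"
    using lower unfolding least .
qed

section \<open>Distance in connected graphs\<close>

locale connected_pair_graph = pair_graph G for G :: "'a pair_pre_digraph" +
  assumes connected: "Digraph_Component.connected (with_proj G)"
begin

abbreviation "V \<equiv> pverts G"
abbreviation "E \<equiv> parcs G"
abbreviation "N \<equiv> neighbours G"
abbreviation "\<delta> \<equiv> graph_dist G"

lemma neighbours_iff: "w \<in> N v \<longleftrightarrow> (v, w) \<in> E"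
  by (simp add: neighbours_def)

lemma neighbours_commute: "w \<in> N v \<longleftrightarrow> v \<in> N w"
  by (auto simp: neighbours_iff dest: arcs_symmetric)

lemma neighbours_subset: "N v \<subseteq> V"
  by (auto simp: neighbours_iff dest: in_arcsD2)

lemma finite_neighbours: "finite (N v)"
  using neighbours_subset pair_finite_verts by (rule finite_subset)

lemma neighbours_irrefl: "v \<notin> N v"
  using no_loops' by (auto simp: neighbours_iff)

lemma awalk_of_length_iff:
  "(\<exists>p. awalk u p v \<and> length p = n) \<longleftrightarrow> u \<in> V \<and> v \<in> V \<and> (u, v) \<in> E ^^ n"
proof (induction n arbitrary: u)
  case 0
  show ?case by (auto simp: awalk_Nil_iff)
next
  case (Suc n)
  have "(\<exists>p. awalk u p v \<and> length p = Suc n) \<longleftrightarrow> (\<exists>w. (u, w) \<in> E \<and> (\<exists>p. awalk w p v \<and> length p = n))"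
  proof
    assume "\<exists>p. awalk u p v \<and> length p = Suc n"
    then obtain e p where "awalk u (e # p) v" "length p = n" by (auto simp: length_Suc_conv)
    then have "(u, snd e) \<in> E \<and> awalk (snd e) p v" by (cases e) (auto simp: awalk_Cons_iff)
    then show "\<exists>w. (u, w) \<in> E \<and> (\<exists>p. awalk w p v \<and> length p = n)"
      using \<open>length p = n\<close> by blast
  next
    assume "\<exists>w. (u, w) \<in> E \<and> (\<exists>p. awalk w p v \<and> length p = n)"
    then obtain w p where "(u, w) \<in> E" "awalk w p v" "length p = n" by blast
    then have "awalk u ((u, w) # p) v" "length ((u, w) # p) = Suc n" by (auto simp: awalk_Cons_iff)
    then show "\<exists>p. awalk u p v \<and> length p = Suc n" by blast
  qed
  also have "\<dots> \<longleftrightarrow> u \<in> V \<and> v \<in> V \<and> (\<exists>w. (u, w) \<in> E \<and> (w, v) \<in> E ^^ n)"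
    unfolding Suc.IH by (auto dest: wellformed')
  also have "\<dots> \<longleftrightarrow> u \<in> V \<and> v \<in> V \<and> (u, v) \<in> E ^^ Suc n"
    by (meson relpow_Suc_I2 relpow_Suc_D2)
  finally show ?case .
qed

lemma dist_eq_Least_relpow:
  assumes "u \<in> V" "v \<in> V" shows "\<delta> u v = (LEAST n. (u, v) \<in> E ^^ n)"
  unfolding graph_dist_def awalk_of_length_iff using assms by simp

lemma dist_le: "u \<in> V \<Longrightarrow> v \<in> V \<Longrightarrow> (u, v) \<in> E ^^ n \<Longrightarrow> \<delta> u v \<le> n"
  by (simp add: dist_eq_Least_relpow Least_le)

lemma relpow_dist:
  assumes "u \<in> V" "v \<in> V" shows "(u, v) \<in> E ^^ \<delta> u v"
proof -
  have "strongly_connected (with_proj G)"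
    using symmetric_connected_imp_strongly_connected connected sym_arcs by blast
  then have "\<exists>p. awalk u p v"
    using assms by (auto simp: strongly_connected_def reachable_awalk)
  then have "\<exists>n. (u, v) \<in> E ^^ n" using awalk_of_length_iff by blast
  then show ?thesis unfolding dist_eq_Least_relpow[OF assms] by (rule LeastI_ex)
qed

lemma dist_commute:
  assumes "u \<in> V" "v \<in> V" shows "\<delta> u v = \<delta> v u"
proof -
  have rev: "(v, u) \<in> E ^^ n" if "(u, v) \<in> E ^^ n" for u v n
    using that
  proof (induction n arbitrary: v)
    case (Suc n)
    then show ?case by (meson arcs_symmetric relpow_Suc_E relpow_Suc_I2)
  qed simp
  then have "(u, v) \<in> E ^^ n \<longleftrightarrow> (v, u) \<in> E ^^ n" for n by blast
  then show ?thesis using assms by (simp add: dist_eq_Least_relpow)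
qed

lemma dist_eq_0_iff: "u \<in> V \<Longrightarrow> v \<in> V \<Longrightarrow> \<delta> u v = 0 \<longleftrightarrow> u = v"
  using relpow_dist[of u v] dist_le[of u v 0] by auto

lemma dist_eq_1_iff:
  assumes "u \<in> V" "v \<in> V" shows "\<delta> u v = 1 \<longleftrightarrow> (u, v) \<in> E"
proof
  assume "\<delta> u v = 1" then show "(u, v) \<in> E" using relpow_dist[OF assms] by simp
next
  assume "(u, v) \<in> E"
  then have "\<delta> u v \<le> 1" "u \<noteq> v" using dist_le[OF assms, of 1] no_loops' by auto
  then show "\<delta> u v = 1" using dist_eq_0_iff[OF assms] by linarith
qed

lemma dist_step_le:
  assumes "u \<in> V" "(v, w) \<in> E" shows "\<delta> u w \<le> \<delta> u v + 1"
proof -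
  have "v \<in> V" "w \<in> V" using assms(2) wellformed' by auto
  moreover have "(u, w) \<in> E ^^ Suc (\<delta> u v)"
    using relpow_dist[OF assms(1) \<open>v \<in> V\<close>] assms(2) by (rule relpow_Suc_I)
  ultimately show ?thesis using dist_le[OF assms(1)] by fastforce
qed

text \<open>
  The first case is stated with \<open>+ 1\<close> on the left, as in the definition of \<open>c\<close>, to keep truncated
  subtraction away.
\<close>

lemma dist_neighbour_cases:
  assumes "u \<in> V" "w \<in> N v"
  shows "\<delta> u w + 1 = \<delta> u v \<or> \<delta> u w = \<delta> u v \<or> \<delta> u w = \<delta> u v + 1"
  using dist_step_le[OF assms(1), of v w] dist_step_le[OF assms(1), of w v] assms(2) arcs_symmetric
  by (force simp: neighbours_iff)

lemma closer_neighbour_exists: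
  assumes "u \<in> V" "v \<in> V" "\<delta> u v = Suc i"
  shows "\<exists>w \<in> N v. \<delta> u w = i"
proof -
  obtain w where w: "(u, w) \<in> E ^^ i" "(w, v) \<in> E"
    using relpow_dist[OF assms(1,2)] unfolding assms(3) by (meson relpow_Suc_E)
  have "w \<in> V" using w(2) wellformed' by auto
  then have "\<delta> u w \<le> i" using dist_le assms(1) w(1) by blast
  moreover have "Suc i \<le> \<delta> u w + 1" using dist_step_le[OF assms(1) w(2)] assms(3) by simp
  ultimately show ?thesis using w(2) arcs_symmetric by (force simp: neighbours_iff)
qed

lemma connected_induct:
  assumes "u \<in> V" "v \<in> V" "P u" "\<And>v w. v \<in> V \<Longrightarrow> P v \<Longrightarrow> w \<in> N v \<Longrightarrow> P w"
  shows "P v"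
proof -
  have "\<delta> u v = i \<Longrightarrow> v \<in> V \<Longrightarrow> P v" for i v
  proof (induction i arbitrary: v)
    case 0
    then show ?case using assms(1,3) dist_eq_0_iff by auto
  next
    case (Suc i)
    then obtain w where "w \<in> N v" "\<delta> u w = i" using closer_neighbour_exists assms(1) by blast
    then show ?case using Suc.IH[of w] assms(4)[of w v] neighbours_subset neighbours_commute by blast
  qed
  then show ?thesis using assms(2) by blast
qed

end

section \<open>Distance-regular graphs and their cosine sequences\<close>

locale distance_regular_graph = connected_pair_graph G for G :: "'a pair_pre_digraph" +
  fixes b c :: "nat \<Rightarrow> nat"
  assumes intersection_numbers:
    "u \<in> V \<Longrightarrow> v \<in> V \<Longrightarrow> card {w \<in> N v. \<delta> u w + 1 = \<delta> u v} = c (\<delta> u v)"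
    "u \<in> V \<Longrightarrow> v \<in> V \<Longrightarrow> card {w \<in> N v. \<delta> u w = \<delta> u v + 1} = b (\<delta> u v)"
begin

abbreviation "Adj \<equiv> adjacency_matrix G"
abbreviation "valency \<equiv> real (b 0)"

text \<open>
  The intersection number \<open>a\<^sub>i\<close>: the number of neighbours of \<open>v\<close> at distance \<open>i\<close> from \<open>u\<close> when
  \<open>u\<close> and \<open>v\<close> are themselves at distance \<open>i\<close>. For \<open>i\<close> beyond the diameter it may be negative.
\<close>

definition a :: "nat \<Rightarrow> real" where
  "a i = valency - b i - c i"

lemma verts_nonempty: "V \<noteq> {}"
  using connected by (auto simp: connected_conv)

lemma Adj_sym: "Adj u v = Adj v u"
  by (auto simp: adjacency_matrix_def dest: arcs_symmetric)

lemma sum_Adj: "(\<Sum>v\<in>V. Adj u v * x v) = (\<Sum>v\<in>N u. x v)"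
proof -
  have "(\<Sum>v\<in>V. Adj u v * x v) = (\<Sum>v\<in>V. if v \<in> N u then x v else 0)"
    by (intro sum.cong) (auto simp: adjacency_matrix_def neighbours_iff)
  also have "\<dots> = (\<Sum>v\<in>N u. x v)"
    using neighbours_subset[of u] pair_finite_verts by (simp add: sum.inter_restrict[symmetric] Int_absorb1)
  finally show ?thesis .
qed

lemma card_neighbours:
  assumes "v \<in> V" shows "card (N v) = b 0"
proof -
  have "\<delta> v w = 1" if "w \<in> N v" for w
    using that assms dist_eq_1_iff in_arcsD2 unfolding neighbours_iff by blast
  then have "{w \<in> N v. \<delta> v w = \<delta> v v + 1} = N v"
    using assms dist_eq_0_iff[of v v] by auto
  then show ?thesis using intersection_numbers(2)[OF assms assms] dist_eq_0_iff[OF assms assms] by simp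
qed

text \<open>
  An entry of the product of the adjacency matrix with a matrix whose entries depend on the distance
  only. At distance 0 the truncated \<open>\<delta> u v - 1\<close> does no harm, as \<open>c 0 = 0\<close>.
\<close>

lemma sum_neighbours_by_distance:
  fixes f :: "nat \<Rightarrow> real"
  assumes "u \<in> V" "v \<in> V"
  shows "(\<Sum>t\<in>N v. f (\<delta> u t)) = c (\<delta> u v) * f (\<delta> u v - 1) + a (\<delta> u v) * f (\<delta> u v)
    + b (\<delta> u v) * f (\<delta> u v + 1)"
proof -
  let ?i = "\<delta> u v"
  let ?C = "{w \<in> N v. \<delta> u w + 1 = ?i}" and ?A = "{w \<in> N v. \<delta> u w = ?i}"
    and ?B = "{w \<in> N v. \<delta> u w = ?i + 1}"
  have fin: "finite ?C" "finite ?A" "finite ?B" using finite_neighbours by auto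
  have N: "N v = ?C \<union> (?A \<union> ?B)" using dist_neighbour_cases[OF assms(1)] by blast
  have split: "(\<Sum>t\<in>N v. g t) = (\<Sum>t\<in>?C. g t) + ((\<Sum>t\<in>?A. g t) + (\<Sum>t\<in>?B. g t))" for g :: "'a \<Rightarrow> real"
    by (subst N, subst sum.union_disjoint, use fin in auto, subst sum.union_disjoint, use fin in auto)
  have "real (card ?A) = a ?i"
    using split[of "\<lambda>_. 1"] card_neighbours[OF assms(2)] intersection_numbers[OF assms]
    by (simp add: a_def)
  moreover have "(\<Sum>t\<in>?C. f (\<delta> u t)) = (\<Sum>t\<in>?C. f (?i - 1))"
    by (intro sum.cong refl arg_cong[where f = f]) auto
  ultimately show ?thesis
    unfolding split using intersection_numbers[OF assms] by simp
qed

definition sphere_sum :: "('a \<Rightarrow> real) \<Rightarrow> 'a \<Rightarrow> nat \<Rightarrow> real" where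
  "sphere_sum x u i = (\<Sum>v | v \<in> V \<and> \<delta> u v = i. x v)"

text \<open>
  Summing the eigenvector equation over the sphere of radius \<open>i\<close> around \<open>u\<close>: by symmetry of the
  adjacency matrix a vertex \<open>w\<close> is counted as often as it has neighbours in that sphere, and this
  number depends on the distance of \<open>w\<close> from \<open>u\<close> only.
\<close>

lemma sphere_sum_recurrence:
  assumes eig: "eigenvector_on V Adj \<theta> x" and u: "u \<in> V"
  shows "\<theta> * sphere_sum x u i = (if i = 0 then 0 else b (i - 1) * sphere_sum x u (i - 1))
    + a i * sphere_sum x u i + c (i + 1) * sphere_sum x u (i + 1)"
proof -
  define ind where "ind j = (if j = i then 1 else 0 :: real)" for j
  have S: "sphere_sum x u j = (\<Sum>v\<in>V. if \<delta> u v = j then x v else 0)" for j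
    unfolding sphere_sum_def using pair_finite_verts by (simp add: sum.inter_filter)
  have "\<theta> * sphere_sum x u i = (\<Sum>v\<in>V. ind (\<delta> u v) * (\<theta> * x v))"
    unfolding S sum_distrib_left by (intro sum.cong) (auto simp: ind_def)
  also have "\<dots> = (\<Sum>v\<in>V. ind (\<delta> u v) * (\<Sum>w\<in>V. Adj v w * x w))"
    using eig by (simp add: eigenvector_on_def)
  also have "\<dots> = (\<Sum>w\<in>V. x w * (\<Sum>v\<in>V. Adj w v * ind (\<delta> u v)))"
    by (rule symmetric_bilinear) (rule Adj_sym)
  also have "\<dots> = (\<Sum>w\<in>V. (if i = 0 then 0 else b (i - 1) * (if \<delta> u w = i - 1 then x w else 0))
      + a i * (if \<delta> u w = i then x w else 0) + c (i + 1) * (if \<delta> u w = i + 1 then x w else 0))"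
  proof (intro sum.cong refl)
    fix w assume w: "w \<in> V"
    have "c 0 = 0" using intersection_numbers(1)[OF u u] dist_eq_0_iff[OF u u] by simp
    then show "x w * (\<Sum>v\<in>V. Adj w v * ind (\<delta> u v))
      = (if i = 0 then 0 else b (i - 1) * (if \<delta> u w = i - 1 then x w else 0))
      + a i * (if \<delta> u w = i then x w else 0) + c (i + 1) * (if \<delta> u w = i + 1 then x w else 0)"
      unfolding sum_Adj sum_neighbours_by_distance[OF u w, where f = ind]
      by (cases "\<delta> u w"; cases i) (auto simp: ind_def)
  qed
  also have "\<dots> = (if i = 0 then 0 else b (i - 1) * sphere_sum x u (i - 1))
    + a i * sphere_sum x u i + c (i + 1) * sphere_sum x u (i + 1)"
    unfolding S by (simp add: sum.distrib sum_distrib_left)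
  finally show ?thesis .
qed

lemma sphere_empty_if_c_eq_0:
  assumes "c (Suc i) = 0" "u \<in> V" "v \<in> V" shows "\<delta> u v \<noteq> Suc i"
proof
  assume eq: "\<delta> u v = Suc i"
  then have "{w \<in> N v. \<delta> u w + 1 = \<delta> u v} \<noteq> {}"
    using closer_neighbour_exists[OF assms(2,3) eq] eq by auto
  moreover have "finite {w \<in> N v. \<delta> u w + 1 = \<delta> u v}" using finite_neighbours by simp
  ultimately show False using intersection_numbers(1)[OF assms(2,3)] eq assms(1) by auto
qed

text \<open>
  The value at \<open>\<theta>\<close> of the polynomial that maps the adjacency matrix to the distance-\<open>i\<close> matrix,
  in other words the eigenvalue of the latter on the \<open>\<theta>\<close>-eigenspace. If \<open>c i = 0\<close>, then there are
  no vertices at distance \<open>i\<close>, and the value 0 of the division is the right one.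
\<close>

fun distance_polynomial :: "real \<Rightarrow> nat \<Rightarrow> real" where
  "distance_polynomial \<theta> 0 = 1"
| "distance_polynomial \<theta> (Suc 0) = (\<theta> - a 0) / c 1"
| "distance_polynomial \<theta> (Suc (Suc i)) =
    ((\<theta> - a (Suc i)) * distance_polynomial \<theta> (Suc i) - b i * distance_polynomial \<theta> i) / c (Suc (Suc i))"

lemma sphere_sum_eigenvector:
  assumes eig: "eigenvector_on V Adj \<theta> x" and u: "u \<in> V"
  shows "sphere_sum x u i = distance_polynomial \<theta> i * x u"
  using eig
proof (induction \<theta> i rule: distance_polynomial.induct[case_names 0 1 step])
  case (0 \<theta>)
  have "{v. v \<in> V \<and> \<delta> u v = 0} = {u}" using dist_eq_0_iff u by auto
  then show ?case by (simp add: sphere_sum_def)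
next
  case (1 \<theta>)
  have "{v. v \<in> V \<and> \<delta> u v = 0} = {u}" using dist_eq_0_iff u by auto
  then have 0: "sphere_sum x u 0 = x u" by (simp add: sphere_sum_def)
  show ?case
  proof (cases "c (Suc 0) = 0")
    case True
    then show ?thesis using sphere_empty_if_c_eq_0[OF True u]
      by (auto simp: sphere_sum_def intro!: sum.neutral)
  next
    case False
    then show ?thesis using sphere_sum_recurrence[OF 1 u, of 0] 0 by (simp add: field_simps)
  qed
next
  case (step \<theta> i)
  show ?case
  proof (cases "c (Suc (Suc i)) = 0")
    case True
    then show ?thesis using sphere_empty_if_c_eq_0[OF True u]
      by (auto simp: sphere_sum_def intro!: sum.neutral)
  next
    case False
    then show ?thesis using sphere_sum_recurrence[OF step.prems u, of "Suc i"] step.IH step.prems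
      by (simp add: field_simps)
  qed
qed

text \<open>
  The constant vector is an eigenvector for the valency, and its sphere sums count vertices. So the
  sizes of spheres are distance polynomials too, which shows in particular that they do not depend
  on the centre.
\<close>

definition sphere_size :: "nat \<Rightarrow> real" where
  "sphere_size i = distance_polynomial valency i"

lemma card_sphere:
  assumes "u \<in> V"
  shows "real (card {v \<in> V. \<delta> u v = i}) = sphere_size i"
proof -
  have "eigenvector_on V Adj valency (\<lambda>_. 1)"
    unfolding eigenvector_on_def sum_Adj by (simp add: card_neighbours)
  from sphere_sum_eigenvector[OF this assms] show ?thesis
    by (simp add: sphere_sum_def sphere_size_def)
qed

text \<open>
  Both sides count the edges between two consecutive spheres around some vertex.
\<close>

lemma edges_between_spheres:
  "sphere_size i * b i = sphere_size (Suc i) * c (Suc i)"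
proof -
  obtain u where u: "u \<in> V" using verts_nonempty by blast
  let ?S = "\<lambda>i. {v \<in> V. \<delta> u v = i}"
  have "(\<Sum>v\<in>?S i. card {w \<in> ?S (Suc i). w \<in> N v}) = (\<Sum>w\<in>?S (Suc i). c (Suc i))"
  proof (rule sum_multicount_gen)
    show "\<forall>w\<in>?S (Suc i). card {v \<in> ?S i. w \<in> N v} = c (Suc i)"
    proof
      fix w assume w: "w \<in> ?S (Suc i)"
      then have "{v \<in> ?S i. w \<in> N v} = {v \<in> N w. \<delta> u v + 1 = \<delta> u w}"
        using neighbours_subset neighbours_commute by auto
      then show "card {v \<in> ?S i. w \<in> N v} = c (Suc i)"
        using intersection_numbers(1)[OF u, of w] w by simp
    qed
  qed (use pair_finite_verts in auto)
  moreover have "card {w \<in> ?S (Suc i). w \<in> N v} = b i" if "v \<in> ?S i" for v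
  proof -
    have "{w \<in> ?S (Suc i). w \<in> N v} = {w \<in> N v. \<delta> u w = \<delta> u v + 1}"
      using neighbours_subset that by auto
    then show ?thesis using intersection_numbers(2)[OF u, of v] that by simp
  qed
  ultimately have "card (?S i) * b i = card (?S (Suc i)) * c (Suc i)" by simp
  then have "real (card (?S i)) * real (b i) = real (card (?S (Suc i))) * real (c (Suc i))"
    by (simp only: of_nat_mult[symmetric])
  then show ?thesis by (simp only: card_sphere[OF u])
qed

text \<open>
  The cosine sequence of \<open>\<theta>\<close>: up to a scalar, the orthogonal projection to the \<open>\<theta>\<close>-eigenspace has
  the entries \<open>cosine \<theta> (\<delta> u v)\<close>. The lemmas below establish what is needed of this fact, namely
  that the columns of this matrix are eigenvectors and that its square is a positive multiple of it.
\<close>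

definition cosine :: "real \<Rightarrow> nat \<Rightarrow> real" where
  "cosine \<theta> i = distance_polynomial \<theta> i / sphere_size i"

lemma cosine_0: "cosine \<theta> 0 = 1"
  by (simp add: cosine_def sphere_size_def)

context
  fixes \<theta> :: real and x :: "'a \<Rightarrow> real"
  assumes eig: "eigenvector_on V Adj \<theta> x" and nonzero: "\<exists>v\<in>V. x v \<noteq> 0"
begin

text \<open>
  The defining recursion of the polynomials yields this only for radii below the diameter. At the
  diameter, where \<open>c (i + 1)\<close> vanishes, the equation characterises the eigenvalues; it
  holds for \<open>\<theta>\<close> because the sphere sums around a vertex with \<open>x v \<noteq> 0\<close> satisfy it.
\<close>

lemma distance_polynomial_recurrence:
  "\<theta> * distance_polynomial \<theta> i = (if i = 0 then 0 else b (i - 1) * distance_polynomial \<theta> (i - 1))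
    + a i * distance_polynomial \<theta> i + c (i + 1) * distance_polynomial \<theta> (i + 1)"
proof -
  obtain v where v: "v \<in> V" "x v \<noteq> 0" using nonzero by blast
  have "(\<theta> * distance_polynomial \<theta> i) * x v
      = ((if i = 0 then 0 else b (i - 1) * distance_polynomial \<theta> (i - 1))
    + a i * distance_polynomial \<theta> i + c (i + 1) * distance_polynomial \<theta> (i + 1)) * x v"
    using sphere_sum_recurrence[OF eig v(1), of i]
    by (simp add: sphere_sum_eigenvector[OF eig v(1)] distrib_right mult.assoc split: if_splits)
  then show ?thesis using v(2) by (metis mult_right_cancel)
qed

text \<open>
  Clears the denominator also for empty spheres: there the polynomial vanishes, being a sphere sum
  divided by a non-zero entry of \<open>x\<close>.
\<close>

lemma sphere_size_times_cosine: "sphere_size i * cosine \<theta> i = distance_polynomial \<theta> i"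
proof (cases "sphere_size i = 0")
  case True
  obtain v where v: "v \<in> V" "x v \<noteq> 0" using nonzero by blast
  have "{w \<in> V. \<delta> v w = i} = {}"
    using card_sphere[OF v(1), of i] True pair_finite_verts by auto
  then have "sphere_sum x v i = 0" unfolding sphere_sum_def by (metis sum.empty)
  then show ?thesis using True v sphere_sum_eigenvector[OF eig v(1)] by simp
qed (simp add: cosine_def)

text \<open>
  After multiplication with the size of the sphere and double counting of edges between
  spheres, the equation for the cosines is the recurrence of the distance polynomials.
\<close>

lemma cosine_column_eigenvector:
  assumes u: "u \<in> V"
  shows "eigenvector_on V Adj \<theta> (\<lambda>v. cosine \<theta> (\<delta> u v))"
  unfolding eigenvector_on_def sum_Adj
proof
  fix v assume v: "v \<in> V"
  let ?w = "cosine \<theta>" and ?p = "distance_polynomial \<theta>" and ?i = "\<delta> u v"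
  have "{v' \<in> V. \<delta> u v' = ?i} \<noteq> {}" using v by auto
  then have pos: "sphere_size ?i \<noteq> 0" using card_sphere[OF u, of ?i] pair_finite_verts by auto
  have "c 0 = 0" using intersection_numbers(1)[OF u u] dist_eq_0_iff[OF u u] by simp
  then have down: "sphere_size i * (c i * ?w (i - 1)) = (if i = 0 then 0 else b (i - 1) * ?p (i - 1))" for i
  proof (cases i)
    case (Suc j)
    have "sphere_size (Suc j) * (c (Suc j) * ?w j) = (sphere_size (Suc j) * c (Suc j)) * ?w j"
      by (simp only: mult.assoc)
    also have "\<dots> = b j * (sphere_size j * ?w j)"
      unfolding edges_between_spheres[symmetric] by (simp only: mult_ac)
    finally show ?thesis using Suc by (simp add: sphere_size_times_cosine)
  qed (simp add: \<open>c 0 = 0\<close>)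
  have up: "sphere_size i * (b i * ?w (i + 1)) = c (i + 1) * ?p (i + 1)" for i
  proof -
    have "sphere_size i * (b i * ?w (i + 1)) = (sphere_size i * b i) * ?w (i + 1)"
      by (simp only: mult.assoc)
    also have "\<dots> = c (i + 1) * (sphere_size (i + 1) * ?w (i + 1))"
      unfolding edges_between_spheres by (simp only: Suc_eq_plus1 mult_ac)
    finally show ?thesis by (simp only: sphere_size_times_cosine)
  qed
  have "sphere_size ?i * (\<Sum>t\<in>N v. ?w (\<delta> u t))
     = sphere_size ?i * (c ?i * ?w (?i - 1)) + a ?i * (sphere_size ?i * ?w ?i)
       + sphere_size ?i * (b ?i * ?w (?i + 1))"
    unfolding sum_neighbours_by_distance[OF u v, where f = ?w] by (simp add: algebra_simps)
  also have "\<dots> = \<theta> * ?p ?i"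
    unfolding down up sphere_size_times_cosine by (subst distance_polynomial_recurrence) simp
  also have "\<dots> = sphere_size ?i * (\<theta> * ?w ?i)"
    by (simp add: sphere_size_times_cosine[symmetric])
  finally show "(\<Sum>t\<in>N v. ?w (\<delta> u t)) = \<theta> * ?w ?i" using pos by simp
qed

lemma cosine_1: "valency * cosine \<theta> 1 = \<theta>"
proof -
  obtain u where u: "u \<in> V" using verts_nonempty by blast
  have "\<delta> u t = 1" if "t \<in> N u" for t
    using that u dist_eq_1_iff in_arcsD2 unfolding neighbours_iff by blast
  then have "(\<Sum>t\<in>N u. cosine \<theta> (\<delta> u t)) = (\<Sum>t\<in>N u. cosine \<theta> 1)" by simp
  then show ?thesis
    using cosine_column_eigenvector[OF u] u dist_eq_0_iff[OF u u]
    by (simp add: eigenvector_on_def sum_Adj card_neighbours cosine_0)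
qed

text \<open>
  A column of the matrix is an eigenvector, so its sphere sums around \<open>u\<close> are fixed multiples of its
  entry at \<open>u\<close>. Grouping the sum over \<open>t\<close> by the distance from \<open>u\<close> thus extracts a factor that
  depends on \<open>\<theta>\<close> only. It is positive, being the squared norm of a column.
\<close>

lemma cosine_matrix_idempotent:
  obtains \<kappa> where "\<kappa> > 0"
    and "\<And>u v. u \<in> V \<Longrightarrow> v \<in> V \<Longrightarrow>
      (\<Sum>t\<in>V. cosine \<theta> (\<delta> u t) * cosine \<theta> (\<delta> v t)) = \<kappa> * cosine \<theta> (\<delta> u v)"
proof -
  let ?w = "cosine \<theta>"
  define D where "D = (\<lambda>(u, v). \<delta> u v) ` (V \<times> V)"
  define \<kappa> where "\<kappa> = (\<Sum>i\<in>D. ?w i * distance_polynomial \<theta> i)"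
  have idem: "(\<Sum>t\<in>V. ?w (\<delta> u t) * ?w (\<delta> v t)) = \<kappa> * ?w (\<delta> u v)" if u: "u \<in> V" and v: "v \<in> V" for u v
  proof -
    have "(\<Sum>t\<in>V. ?w (\<delta> u t) * ?w (\<delta> v t))
        = (\<Sum>i\<in>D. \<Sum>t | t \<in> V \<and> \<delta> u t = i. ?w (\<delta> u t) * ?w (\<delta> v t))"
      using u pair_finite_verts by (intro sum.group[symmetric]) (auto simp: D_def)
    also have "\<dots> = (\<Sum>i\<in>D. ?w i * sphere_sum (\<lambda>t. ?w (\<delta> v t)) u i)"
      unfolding sphere_sum_def sum_distrib_left by (intro sum.cong) auto
    also have "\<dots> = \<kappa> * ?w (\<delta> v u)"
      unfolding sphere_sum_eigenvector[OF cosine_column_eigenvector[OF v] u] \<kappa>_def sum_distrib_right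
      by (simp add: mult.assoc)
    finally show ?thesis by (simp only: dist_commute[OF u v])
  qed
  obtain u where u: "u \<in> V" using verts_nonempty by blast
  have "\<delta> u u = 0" using dist_eq_0_iff u by blast
  have "0 < norm_sq_on V (\<lambda>t. ?w (\<delta> u t))"
    using u \<open>\<delta> u u = 0\<close> by (intro norm_sq_on_pos[OF pair_finite_verts u]) (simp add: cosine_0)
  also have "\<dots> = \<kappa>"
    using idem[OF u u] by (simp add: norm_sq_on_def power2_eq_square \<open>\<delta> u u = 0\<close> cosine_0)
  finally show thesis using idem by (rule that)
qed

end


end

section \<open>Cliques and colourings against the least eigenvalue\<close>

context connected_pair_graph
begin

definition clique :: "'a set \<Rightarrow> bool" where
  "clique Q \<longleftrightarrow> Q \<subseteq> V \<and> (\<forall>u\<in>Q. \<forall>v\<in>Q. u \<noteq> v \<longrightarrow> (u, v) \<in> E)"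

definition coclique :: "'a set \<Rightarrow> bool" where
  "coclique I \<longleftrightarrow> I \<subseteq> V \<and> (\<forall>u\<in>I. \<forall>v\<in>I. (u, v) \<notin> E)"

lemma clique_neighbour: "clique Q \<Longrightarrow> u \<in> Q \<Longrightarrow> v \<in> Q \<Longrightarrow> v \<noteq> u \<Longrightarrow> v \<in> N u"
  by (simp add: clique_def neighbours_iff)

lemma clique_insert:
  assumes "clique Q" "v \<in> V" "Q \<subseteq> N v" shows "clique (insert v Q)"
proof -
  have "(v, u) \<in> E" "(u, v) \<in> E" if "u \<in> Q" for u
    using that assms(3) arcs_symmetric by (auto simp: neighbours_def)
  then show ?thesis using assms(1,2) by (simp add: clique_def)
qed

lemma clique_subset: "clique Q \<Longrightarrow> Q \<subseteq> V"
  by (simp add: clique_def)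

lemma finite_clique: "clique Q \<Longrightarrow> finite Q"
  using pair_finite_verts finite_subset unfolding clique_def by blast

lemma finite_coclique: "coclique I \<Longrightarrow> finite I"
  using pair_finite_verts finite_subset unfolding coclique_def by blast

lemma card_clique_Int_coclique_le_1:
  assumes "clique Q" "coclique I" shows "card (Q \<inter> I) \<le> 1"
proof -
  have "u = v" if "u \<in> Q \<inter> I" "v \<in> Q \<inter> I" for u v
    using assms that unfolding clique_def coclique_def by blast
  then show ?thesis by (simp add: card_le_Suc0_iff_eq finite_clique[OF assms(1)])
qed

lemma edge_leaving_exists:
  assumes "Q \<subseteq> V" "Q \<noteq> {}" "Q \<noteq> V"
  shows "\<exists>u\<in>Q. N u - Q \<noteq> {}"
proof (rule ccontr)
  assume "\<not> ?thesis"
  then have closed: "N u \<subseteq> Q" if "u \<in> Q" for u using that by blast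
  obtain u where u: "u \<in> Q" using assms by blast
  have "v \<in> Q" if "v \<in> V" for v
    by (rule connected_induct[of u v "\<lambda>v. v \<in> Q"]) (use u that assms(1) closed in blast)+
  then show False using assms by blast
qed

end

context distance_regular_graph
begin

text \<open>
  Hoffman's ratio bound for cocliques: evaluate the Rayleigh quotient at the characteristic vector
  of \<open>I\<close>, shifted by a constant so that it becomes orthogonal to the constant vector.
\<close>

lemma ratio_bound:
  fixes \<theta> :: real
  assumes lower: "\<And>y. \<theta> * norm_sq_on V y \<le> quadratic_form V Adj y" and I: "coclique I"
  shows "card I * (valency - \<theta>) \<le> - \<theta> * card V"
proof (cases "I = {}")
  case True
  (* What remains is that the least eigenvalue is not positive: the diagonal of Adj is zero. *)
  have "quadratic_form V Adj (indicator {u}) = 0" if "u \<in> V" for u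
    using neighbours_irrefl unfolding quadratic_form_def sum_Adj
    by (intro sum.neutral) (auto simp: indicator_def intro!: sum.neutral)
  moreover obtain u where u: "u \<in> V" using verts_nonempty by blast
  moreover have "norm_sq_on V (indicator {u}) > 0"
    using u by (intro norm_sq_on_pos[OF pair_finite_verts u]) simp
  ultimately have "\<theta> \<le> 0" using lower[of "indicator {u}"] by (simp add: mult_le_0_iff)
  then show ?thesis using True by (simp add: mult_nonpos_nonneg)
next
  case False
  define s where "s = real (card I)"
  define n where "n = real (card V)"
  define x :: "'a \<Rightarrow> real" where "x = indicator I"
  (* The shift that makes the entries of x + t sum to zero. *)
  define t where "t = - s / n"
  have IV: "I \<subseteq> V" using I by (simp add: coclique_def)
  have "s > 0" using False finite_coclique[OF I] by (simp add: s_def card_gt_0_iff)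
  have "n > 0" using verts_nonempty pair_finite_verts by (simp add: n_def card_gt_0_iff)
  have sumx: "(\<Sum>u\<in>V. x u) = s"
    using IV pair_finite_verts by (simp add: x_def s_def indicator_def sum.inter_filter[symmetric] Int_def[symmetric] Int_absorb1)
  have deg: "(\<Sum>v\<in>V. Adj u v * 1) = valency" if "u \<in> V" for u
    unfolding sum_Adj by (simp add: card_neighbours that)
  have "quadratic_form V Adj x = 0"
    unfolding quadratic_form_def sum_Adj x_def using I
    by (intro sum.neutral) (auto simp: indicator_def coclique_def neighbours_iff intro!: sum.neutral)
  moreover have "(\<Sum>u\<in>V. 1 * (\<Sum>v\<in>V. Adj u v * x v)) = (\<Sum>u\<in>V. x u * (\<Sum>v\<in>V. Adj u v * 1))"
    by (rule symmetric_bilinear) (rule Adj_sym)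
  moreover have "\<dots> = valency * s"
    using deg by (simp add: sumx[symmetric] sum_distrib_left mult.commute)
  moreover have "quadratic_form V Adj (\<lambda>_. 1) = valency * n"
    unfolding quadratic_form_def using deg by (simp add: n_def)
  moreover have "quadratic_form V Adj (\<lambda>u. x u + t * 1) = quadratic_form V Adj x
      + 2 * t * (\<Sum>u\<in>V. 1 * (\<Sum>v\<in>V. Adj u v * x v)) + t\<^sup>2 * quadratic_form V Adj (\<lambda>_. 1)"
    by (rule quadratic_form_add) (rule Adj_sym)
  ultimately have Q: "quadratic_form V Adj (\<lambda>u. x u + t) = - valency * s\<^sup>2 / n"
    using \<open>n > 0\<close> by (simp add: t_def power2_eq_square field_simps)
  have "norm_sq_on V (\<lambda>u. x u + t) = (\<Sum>u\<in>V. x u + 2 * t * x u + t\<^sup>2)"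
    unfolding norm_sq_on_def
    by (intro sum.cong refl) (auto simp: x_def indicator_def power2_eq_square algebra_simps)
  also have "\<dots> = s - s\<^sup>2 / n"
    using \<open>n > 0\<close> by (simp add: sum.distrib sum_distrib_left[symmetric] sumx n_def[symmetric])
      (simp add: t_def power2_eq_square field_simps)
  finally have "\<theta> * (s - s\<^sup>2 / n) \<le> - valency * s\<^sup>2 / n"
    using lower[of "\<lambda>u. x u + t"] Q by simp
  moreover have "\<theta> * (s - s\<^sup>2 / n) = (s / n) * (\<theta> * (n - s))"
    and "- valency * s\<^sup>2 / n = (s / n) * (- valency * s)"
    using \<open>n > 0\<close> by (simp_all add: power2_eq_square field_simps)
  moreover have "s / n > 0" using \<open>s > 0\<close> \<open>n > 0\<close> by simp
  ultimately have "\<theta> * (n - s) \<le> - valency * s" by (simp only: mult_le_cancel_left_pos)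
  then show ?thesis by (simp add: s_def n_def algebra_simps)
qed

text \<open>
  Hoffman's bound on the chromatic number: the colour classes cover the vertices, and the ratio
  bound limits the size of each.
\<close>

lemma colouring_bound:
  fixes \<theta> :: real
  assumes lower: "\<And>y. \<theta> * norm_sq_on V y \<le> quadratic_form V Adj y"
    and proper: "\<And>u v. (u, v) \<in> E \<Longrightarrow> \<phi> u \<noteq> \<phi> v" and C: "\<phi> ` V \<subseteq> C" "finite C"
  shows "valency - \<theta> \<le> - \<theta> * card C"
proof -
  have "card V = (\<Sum>i\<in>C. card {v \<in> V. \<phi> v = i})"
    using sum.group[OF pair_finite_verts C(2,1), of "\<lambda>_. 1::nat"] by simp
  then have "real (card V) * (valency - \<theta>) = (\<Sum>i\<in>C. card {v \<in> V. \<phi> v = i} * (valency - \<theta>))"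
    by (simp add: sum_distrib_right)
  also have "\<dots> \<le> (\<Sum>i\<in>C. - \<theta> * card V)"
  proof (intro sum_mono ratio_bound[OF lower])
    show "coclique {v \<in> V. \<phi> v = i}" for i
      using proper unfolding coclique_def by blast
  qed
  also have "\<dots> = real (card V) * (- \<theta> * card C)" by simp
  finally have "real (card V) * (valency - \<theta>) \<le> real (card V) * (- \<theta> * card C)" .
  moreover have "real (card V) > 0" using verts_nonempty pair_finite_verts by (simp add: card_gt_0_iff)
  ultimately show ?thesis by (simp only: mult_le_cancel_left_pos)
qed

context
  fixes \<theta> :: real and x :: "'a \<Rightarrow> real"
  assumes eig: "eigenvector_on V Adj \<theta> x" and nonzero: "\<exists>v\<in>V. x v \<noteq> 0"
begin

text \<open>
  The left-hand side is the squared norm of the image of the characteristic vector of \<open>Q\<close> under the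
  cosine matrix. As the square of this matrix is a multiple of it, the entries of the matrix on \<open>Q\<close>
  remain, which are 1 on the diagonal and \<open>cosine \<theta> 1\<close> elsewhere.
\<close>

lemma clique_cosine_sum_squares:
  obtains \<kappa> where "\<kappa> > 0"
    and "\<And>Q. clique Q \<Longrightarrow>
      (\<Sum>t\<in>V. (\<Sum>u\<in>Q. cosine \<theta> (\<delta> u t))\<^sup>2) = \<kappa> * (card Q * (1 + (real (card Q) - 1) * cosine \<theta> 1))"
proof -
  let ?w = "cosine \<theta>"
  obtain \<kappa> where \<kappa>: "\<kappa> > 0" and idem: "\<And>u v. u \<in> V \<Longrightarrow> v \<in> V \<Longrightarrow>
      (\<Sum>t\<in>V. ?w (\<delta> u t) * ?w (\<delta> v t)) = \<kappa> * ?w (\<delta> u v)"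
    using cosine_matrix_idempotent[OF eig nonzero] by blast
  have "(\<Sum>t\<in>V. (\<Sum>u\<in>Q. ?w (\<delta> u t))\<^sup>2) = \<kappa> * (card Q * (1 + (real (card Q) - 1) * ?w 1))"
    if Q: "clique Q" for Q
  proof -
    have QV: "Q \<subseteq> V" using Q by (simp add: clique_def)
    have fin: "finite Q" using Q by (rule finite_clique)
    have "(\<Sum>t\<in>V. (\<Sum>u\<in>Q. ?w (\<delta> u t))\<^sup>2) = (\<Sum>t\<in>V. \<Sum>u\<in>Q. \<Sum>v\<in>Q. ?w (\<delta> u t) * ?w (\<delta> v t))"
      by (simp add: power2_eq_square sum_product)
    also have "\<dots> = (\<Sum>u\<in>Q. \<Sum>t\<in>V. \<Sum>v\<in>Q. ?w (\<delta> u t) * ?w (\<delta> v t))" by (rule sum.swap)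
    also have "\<dots> = (\<Sum>u\<in>Q. \<Sum>v\<in>Q. \<Sum>t\<in>V. ?w (\<delta> u t) * ?w (\<delta> v t))"
      by (intro sum.cong refl sum.swap)
    also have "\<dots> = (\<Sum>u\<in>Q. \<kappa> * (1 + (real (card Q) - 1) * ?w 1))"
    proof (intro sum.cong refl)
      fix u assume u: "u \<in> Q"
      have "(\<Sum>v\<in>Q. \<Sum>t\<in>V. ?w (\<delta> u t) * ?w (\<delta> v t)) = (\<Sum>v\<in>Q. \<kappa> * ?w (\<delta> u v))"
        using u QV by (intro sum.cong refl idem) auto
      also have "\<dots> = \<kappa> * ?w (\<delta> u u) + (\<Sum>v\<in>Q - {u}. \<kappa> * ?w (\<delta> u v))"
        using u fin by (simp add: sum.remove)
      also have "(\<Sum>v\<in>Q - {u}. \<kappa> * ?w (\<delta> u v)) = (\<Sum>v\<in>Q - {u}. \<kappa> * ?w 1)"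
      proof (intro sum.cong refl)
        fix v assume "v \<in> Q - {u}"
        then have "u \<in> V" "v \<in> V" "(u, v) \<in> E" using u Q QV by (auto simp: clique_def)
        then have "\<delta> u v = 1" using dist_eq_1_iff by blast
        then show "\<kappa> * ?w (\<delta> u v) = \<kappa> * ?w 1" by simp
      qed
      also have "\<dots> = (real (card Q) - 1) * (\<kappa> * ?w 1)"
      proof -
        have "card Q = Suc (card (Q - {u}))" using u fin by (metis card.remove)
        then show ?thesis by simp
      qed
      also have "?w (\<delta> u u) = 1" using u QV dist_eq_0_iff[of u u] by (auto simp: cosine_0)
      finally show "(\<Sum>v\<in>Q. \<Sum>t\<in>V. ?w (\<delta> u t) * ?w (\<delta> v t)) = \<kappa> * (1 + (real (card Q) - 1) * ?w 1)"
        by (simp add: algebra_simps)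
    qed
    finally show ?thesis by simp
  qed
  with \<kappa> show thesis by (rule that)
qed

text \<open>
  Delsarte's clique bound, in a form without division by \<open>\<theta>\<close>: a squared norm is non-negative, and
  \<open>cosine \<theta> 1 = \<theta> / k\<close>.
\<close>

lemma clique_bound:
  assumes Q: "clique Q" "Q \<noteq> {}"
  shows "valency + (real (card Q) - 1) * \<theta> \<ge> 0"
proof -
  obtain \<kappa> where "\<kappa> > 0" and sq: "(\<Sum>t\<in>V. (\<Sum>u\<in>Q. cosine \<theta> (\<delta> u t))\<^sup>2)
      = \<kappa> * (card Q * (1 + (real (card Q) - 1) * cosine \<theta> 1))"
    using clique_cosine_sum_squares Q(1) by blast
  have "0 \<le> \<kappa> * (card Q * (1 + (real (card Q) - 1) * cosine \<theta> 1))"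
    unfolding sq[symmetric] by (simp add: sum_nonneg)
  moreover have "card Q > 0" using Q finite_clique by (simp add: card_gt_0_iff)
  ultimately have "0 \<le> 1 + (real (card Q) - 1) * cosine \<theta> 1"
    using \<open>\<kappa> > 0\<close> by (simp add: zero_le_mult_iff)
  then have "0 \<le> valency * (1 + (real (card Q) - 1) * cosine \<theta> 1)" by simp
  also have "\<dots> = valency + (real (card Q) - 1) * (valency * cosine \<theta> 1)" by (simp add: algebra_simps)
  finally show ?thesis by (simp only: cosine_1[OF eig nonzero])
qed

lemma tight_clique_cosine_sum:
  assumes Q: "clique Q" and tight: "valency + (real (card Q) - 1) * \<theta> = 0" and "b 0 > 0" and t: "t \<in> V"
  shows "(\<Sum>u\<in>Q. cosine \<theta> (\<delta> u t)) = 0"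
proof -
  obtain \<kappa> where "\<kappa> > 0" and sq: "(\<Sum>t\<in>V. (\<Sum>u\<in>Q. cosine \<theta> (\<delta> u t))\<^sup>2)
      = \<kappa> * (card Q * (1 + (real (card Q) - 1) * cosine \<theta> 1))"
    using clique_cosine_sum_squares Q(1) by blast
  have "valency * (1 + (real (card Q) - 1) * cosine \<theta> 1)
      = valency + (real (card Q) - 1) * (valency * cosine \<theta> 1)" by (simp add: algebra_simps)
  also have "\<dots> = 0" by (simp only: cosine_1[OF eig nonzero] tight)
  finally have "1 + (real (card Q) - 1) * cosine \<theta> 1 = 0" using \<open>b 0 > 0\<close> by simp
  then have "(\<Sum>t\<in>V. (\<Sum>u\<in>Q. cosine \<theta> (\<delta> u t))\<^sup>2) = 0" using sq by simp
  then show ?thesis using t pair_finite_verts by (simp add: sum_nonneg_eq_0_iff)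
qed

text \<open>
  A vertex outside \<open>Q\<close> with \<open>m > 0\<close> neighbours in \<open>Q\<close> has distance 2 to the rest of \<open>Q\<close>. The
  vanishing cosine sum then reads \<open>m w\<^sub>1 + (|Q| - m) w\<^sub>2 = 0\<close>. This determines \<open>m\<close>, since
  \<open>w\<^sub>1 = w\<^sub>2\<close> would force \<open>|Q| w\<^sub>1 = 0\<close>, whereas \<open>k w\<^sub>1 = \<theta> \<noteq> 0\<close>.
\<close>

lemma tight_clique_outside_degree:
  assumes Q: "clique Q" and tight: "valency + (real (card Q) - 1) * \<theta> = 0" and pos: "b 0 > 0"
  shows "\<exists>m. \<forall>t\<in>V - Q. N t \<inter> Q \<noteq> {} \<longrightarrow> card (N t \<inter> Q) = m"
proof -
  let ?w = "cosine \<theta>"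
  have fin: "finite Q" using Q by (rule finite_clique)
  have w1: "?w 1 \<noteq> 0"
    using cosine_1[OF eig nonzero] tight pos by auto
  have eq: "card (N t \<inter> Q) * (?w 2 - ?w 1) = card Q * ?w 2" if t: "t \<in> V - Q" "N t \<inter> Q \<noteq> {}" for t
  proof -
    obtain v where v: "v \<in> N t" "v \<in> Q" using t by blast
    have d: "\<delta> u t = (if u \<in> N t then 1 else 2)" if u: "u \<in> Q" for u
    proof -
      have uV: "u \<in> V" "t \<in> V" "u \<noteq> t" using u t Q by (auto simp: clique_def)
      have vV: "v \<in> V" using v(1) neighbours_subset by blast
      have "\<delta> u v \<le> 1"
        using u v(2) Q dist_eq_1_iff[OF uV(1) vV] dist_eq_0_iff[OF uV(1) vV]
        by (cases "u = v") (auto simp: clique_def)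
      then have "\<delta> u t \<le> 2"
        using dist_step_le[OF uV(1), of v t] v(1) arcs_symmetric by (force simp: neighbours_iff)
      moreover have "\<delta> u t \<noteq> 0" using dist_eq_0_iff uV by blast
      moreover have "\<delta> u t = 1 \<longleftrightarrow> u \<in> N t"
        using dist_eq_1_iff[OF uV(1,2)] neighbours_commute by (simp add: neighbours_iff)
      ultimately show ?thesis by auto
    qed
    have "0 = (\<Sum>u\<in>Q. ?w (\<delta> u t))" using tight_clique_cosine_sum[OF Q tight pos] t by simp
    also have "\<dots> = (\<Sum>u\<in>Q. ?w 2 + (if u \<in> N t then ?w 1 - ?w 2 else 0))"
      using d by (intro sum.cong) auto
    also have "\<dots> = card Q * ?w 2 + card (N t \<inter> Q) * (?w 1 - ?w 2)"
      using fin by (simp add: sum.distrib sum.inter_filter[symmetric] Int_def conj_commute)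
    finally show ?thesis by (simp add: algebra_simps)
  qed
  have "card (N t \<inter> Q) = card (N t' \<inter> Q)"
    if t: "t \<in> V - Q" "N t \<inter> Q \<noteq> {}" and t': "t' \<in> V - Q" "N t' \<inter> Q \<noteq> {}" for t t'
  proof -
    have "card Q > 0" using t fin by (auto simp: card_gt_0_iff)
    then have "?w 2 - ?w 1 \<noteq> 0" using eq[OF t] w1 by auto
    then show ?thesis using eq[OF t] eq[OF t'] by (metis mult_right_cancel of_nat_eq_iff)
  qed
  then show ?thesis by blast
qed

end

section \<open>Neighbourhoods of vertices in a tight clique\<close>

text \<open>
  These are the neighbours of \<open>u\<close> at distance 2 from \<open>v\<close>.
\<close>

lemma non_neighbours_in_neighbourhood:
  assumes "u \<in> V" "v \<in> N u"
  shows "card {w \<in> N u. w \<noteq> v \<and> w \<notin> N v} = b 1"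
proof -
  have v: "v \<in> V" using assms neighbours_subset by blast
  have duv: "\<delta> v u = 1" using dist_eq_1_iff[OF v assms(1)] assms(2) neighbours_commute by (simp add: neighbours_iff)
  have "\<delta> v w = 2 \<longleftrightarrow> w \<noteq> v \<and> w \<notin> N v" if "w \<in> N u" for w
  proof -
    have w: "w \<in> V" using that neighbours_subset by blast
    have "\<delta> v w = 0 \<or> \<delta> v w = 1 \<or> \<delta> v w = 2"
      using dist_neighbour_cases[OF v that] duv by auto
    moreover have "\<delta> v w = 0 \<longleftrightarrow> w = v" using dist_eq_0_iff[OF v w] by auto
    moreover have "\<delta> v w = 1 \<longleftrightarrow> w \<in> N v"
      unfolding neighbours_iff by (rule dist_eq_1_iff[OF v w])
    ultimately show ?thesis by auto
  qed
  then have "{w \<in> N u. w \<noteq> v \<and> w \<notin> N v} = {w \<in> N u. \<delta> v w = \<delta> v u + 1}"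
    unfolding duv one_add_one by blast
  then show ?thesis using intersection_numbers(2)[OF v assms(1)] duv by simp
qed

text \<open>
  Every vertex of the neighbourhood of \<open>u\<close> has \<open>b 1\<close> non-neighbours in it. Those of a vertex of
  \<open>Q - {u}\<close> all lie in \<open>L\<close>; those of a vertex of \<open>L\<close> are \<open>|Q| - m > 0\<close> vertices of \<open>Q\<close> and some
  vertices of \<open>L\<close>, so \<open>|Q| - m \<le> b 1\<close>. Counting the non-adjacent pairs between \<open>Q - {u}\<close> and \<open>L\<close> in
  two ways gives \<open>(|Q| - 1) b 1 = |L| (|Q| - m)\<close>, whence the first claim. If it holds with equality,
  then \<open>|Q| - m = b 1\<close>, and no non-neighbours within \<open>L\<close> remain.
\<close>

lemma tight_clique_neighbourhood:
  assumes Q: "clique Q" and u: "u \<in> Q" and L: "L = N u - Q" "L \<noteq> {}"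
    and deg: "\<And>t. t \<in> V - Q \<Longrightarrow> N t \<inter> Q \<noteq> {} \<Longrightarrow> card (N t \<inter> Q) = m" and m: "m < card Q"
  shows "card Q - 1 \<le> card L" and "card L = card Q - 1 \<Longrightarrow> clique L"
proof -
  let ?P = "Q - {u}" and ?s = "card Q - m"
  have fin: "finite Q" "finite L" using Q finite_clique finite_neighbours by (auto simp: L)
  have uV: "u \<in> V" using Q u by (auto simp: clique_def)
  have P: "?P \<subseteq> N u" using clique_neighbour[OF Q u] by blast
  have LV: "L \<subseteq> V" using L neighbours_subset by blast
  have fromP: "card {l \<in> L. l \<notin> N p} = b 1" if p: "p \<in> ?P" for p
  proof -
    have "w \<in> N p" if "w \<in> Q" "w \<noteq> p" for w
      using clique_neighbour[OF Q] that p by blast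
    then have "{w \<in> N u. w \<noteq> p \<and> w \<notin> N p} = {l \<in> L. l \<notin> N p}"
      using p unfolding L(1) by blast
    moreover have "p \<in> N u" using p P by blast
    ultimately show ?thesis using non_neighbours_in_neighbourhood[OF uV] by metis
  qed
  have toP: "card {p \<in> ?P. l \<notin> N p} = ?s" if l: "l \<in> L" for l
  proof -
    have "u \<in> N l" using l L neighbours_commute by blast
    then have "{p \<in> ?P. l \<notin> N p} = Q - (N l \<inter> Q)" using neighbours_commute by blast
    moreover have "card (N l \<inter> Q) = m" using deg[of l] l LV L \<open>u \<in> N l\<close> u by blast
    ultimately show ?thesis using fin by (simp add: card_Diff_subset)
  qed
  have inL: "?s + card {l' \<in> L. l' \<noteq> l \<and> l' \<notin> N l} = b 1" if l: "l \<in> L" for l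
  proof -
    have lN: "l \<in> N u" using l L by blast
    have "u \<notin> N u" by (rule neighbours_irrefl)
    then have "{w \<in> N u. w \<noteq> l \<and> w \<notin> N l} = {p \<in> ?P. l \<notin> N p} \<union> {l' \<in> L. l' \<noteq> l \<and> l' \<notin> N l}"
      using P l neighbours_commute unfolding L(1) by blast
    moreover have "{p \<in> ?P. l \<notin> N p} \<inter> {l' \<in> L. l' \<noteq> l \<and> l' \<notin> N l} = {}" using L by blast
    ultimately show ?thesis
      using non_neighbours_in_neighbourhood[OF uV lN] toP[OF l] fin by (simp add: card_Un_disjoint)
  qed
  have "(\<Sum>p\<in>?P. card {l \<in> L. l \<notin> N p}) = (\<Sum>l\<in>L. ?s)"
    by (rule sum_multicount_gen) (use fin toP in auto)
  then have count: "(card Q - 1) * b 1 = card L * ?s"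
    using fromP u fin by simp
  obtain l where "l \<in> L" using L by blast
  then have s: "?s \<le> b 1" "0 < ?s" using inL[of l] m by auto
  have "(card Q - 1) * b 1 \<le> card L * b 1" unfolding count using s by simp
  then show "card Q - 1 \<le> card L" using s by simp
  show "clique L" if eq: "card L = card Q - 1"
  proof -
    have "card L > 0" using L fin by (simp add: card_gt_0_iff)
    then have "b 1 = ?s" using count eq by simp
    then have none: "{l' \<in> L. l' \<noteq> l \<and> l' \<notin> N l} = {}" if "l \<in> L" for l
      using inL[OF that] fin by simp
    then show ?thesis using LV unfolding clique_def neighbours_iff by blast
  qed
qed

text \<open>
  The clique bound and the colouring bound meet, so every clique of the order of \<open>Q\<close> is tight, and
  none is larger. The neighbourhood lemma then bounds the valency \<open>-\<theta> (n - 1)\<close> from below by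
  \<open>2 (n - 1)\<close>. In case of equality it also produces, from a clique \<open>R\<close> of order \<open>n\<close> through a
  vertex \<open>w\<close>, a second one through \<open>w\<close>, and the two together contain all neighbours of \<open>w\<close>; so a
  vertex reachable from \<open>Q\<close> lies in such a clique as well.
\<close>

lemma clique_attaining_chromatic_number:
  fixes \<theta> :: real
  assumes Q: "clique Q" "Q \<noteq> {}" "Q \<noteq> V"
    and \<phi>: "\<And>u v. (u, v) \<in> E \<Longrightarrow> \<phi> u \<noteq> \<phi> v" "\<phi> ` V \<subseteq> C" "finite C" "card C = card Q"
    and \<theta>: "\<theta> = least_graph_eigenvalue G"
  shows "\<theta> \<le> -2"
    and "\<theta> = -2 \<Longrightarrow> v \<in> V \<Longrightarrow> \<exists>A B. N v = A \<union> B \<and> clique A \<and> clique B"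
proof -
  have pg: "pair_graph G" by (rule pair_graph)
  obtain x where x: "\<exists>v\<in>V. x v \<noteq> 0" "eigenvector_on V Adj \<theta> x"
    using least_graph_eigenvalue_rayleigh(1)[OF pg verts_nonempty] \<theta> by blast
  have "finite Q" using Q finite_clique by blast
  define n where "n = card Q"
  have "n > 0" using Q \<open>finite Q\<close> by (simp add: n_def card_gt_0_iff)
  have maximal: "card R \<le> n" if "clique R" for R
  proof -
    have "inj_on \<phi> R"
    proof (rule inj_onI, rule ccontr)
      fix u v assume "u \<in> R" "v \<in> R" "\<phi> u = \<phi> v" "u \<noteq> v"
      then show False using that \<phi>(1)[of u v] by (simp add: clique_def)
    qed
    moreover have "\<phi> ` R \<subseteq> C" using \<phi>(2) clique_subset[OF that] by blast
    ultimately show ?thesis using card_inj_on_le[of \<phi> R C] \<phi>(3,4) by (simp add: n_def)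
  qed
  have lower: "\<theta> * norm_sq_on V y \<le> quadratic_form V Adj y" for y
    using least_graph_eigenvalue_rayleigh(2)[OF pg verts_nonempty] \<theta> by blast
  have "valency - \<theta> \<le> - \<theta> * card C" by (rule colouring_bound[OF lower \<phi>(1-3)])
  moreover have "valency + (real n - 1) * \<theta> \<ge> 0"
    unfolding n_def by (rule clique_bound[OF x(2,1) Q(1,2)])
  ultimately have tight: "valency + (real n - 1) * \<theta> = 0"
    using \<phi>(4) by (simp add: n_def algebra_simps)
  have split: "card (N u) = n - 1 + card (N u - R)" if "clique R" "card R = n" "u \<in> R" for R u
  proof -
    have "R - {u} \<subseteq> N u" using clique_neighbour that by blast
    then have "N u = (R - {u}) \<union> (N u - R)" using neighbours_irrefl[of u] by auto
    then have "card (N u) = card (R - {u}) + card (N u - R)"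
      using finite_clique[OF that(1)] finite_neighbours[of u]
      by (metis card_Un_disjoint Diff_disjoint Int_Diff Int_commute finite_Diff Int_absorb2 Diff_subset Diff_Int_distrib2)
    then show ?thesis using that finite_clique[OF that(1)] by simp
  qed
  have valency: "b 0 \<ge> n"
  proof -
    obtain u where u: "u \<in> Q" "N u - Q \<noteq> {}"
      using edge_leaving_exists[OF clique_subset[OF Q(1)] Q(2,3)] by blast
    then have "card (N u - Q) > 0" using finite_neighbours by (simp add: card_gt_0_iff)
    moreover have "card (N u) = b 0" using u Q card_neighbours by (auto simp: clique_def)
    ultimately show ?thesis using split[OF Q(1), of u] u by (simp add: n_def)
  qed
  have nbhd: "real n - 1 \<le> card (N u - R) \<and> (card (N u - R) = n - 1 \<longrightarrow> clique (N u - R))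
      \<and> card (N u - R) + (n - 1) = b 0"
    if R: "clique R" "card R = n" "u \<in> R" for R u
  proof -
    have uV: "u \<in> V" using R by (auto simp: clique_def)
    have cnt: "card (N u - R) + (n - 1) = b 0" using split[OF R] card_neighbours[OF uV] by simp
    then have "card (N u - R) \<noteq> 0" using valency \<open>n > 0\<close> by linarith
    then have "N u - R \<noteq> {}" by (metis card.empty)
    then obtain l where l: "l \<in> N u" "l \<notin> R" by blast
    have lV: "l \<in> V - R" "N l \<inter> R \<noteq> {}" using l neighbours_subset neighbours_commute R(3) by blast+
    have "b 0 > 0" using valency \<open>n > 0\<close> by simp
    then obtain m where m: "\<forall>t\<in>V - R. N t \<inter> R \<noteq> {} \<longrightarrow> card (N t \<inter> R) = m"
      using tight_clique_outside_degree[OF x(2,1) R(1)] tight R(2) by blast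
    have "m < card R"
    proof (rule ccontr)
      assume "\<not> m < card R"
      then have "card R \<le> card (N l \<inter> R)" using m lV by auto
      then have "N l \<inter> R = R" using finite_clique[OF R(1)] by (meson Int_lower2 card_seteq)
      then have "clique (insert l R)"
        using R(1) lV by (intro clique_insert) auto
      then have "card (insert l R) \<le> n" by (rule maximal)
      then show False using l(2) finite_clique[OF R(1)] R(2) by simp
    qed
    from tight_clique_neighbourhood[OF R(1,3) refl \<open>N u - R \<noteq> {}\<close> _ this] m
    have "card R - 1 \<le> card (N u - R)" "card (N u - R) = card R - 1 \<Longrightarrow> clique (N u - R)" by blast+
    then show ?thesis using cnt R(2) by auto
  qed
  obtain u where u: "u \<in> Q" using Q by blast
  have "n \<noteq> 1" using tight valency \<open>n > 0\<close> by auto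
  then have n1: "real n - 1 > 0" using \<open>n > 0\<close> by simp
  have "valency \<ge> 2 * (real n - 1)"
    using nbhd[OF Q(1) _ u] \<open>n > 0\<close> by (simp add: n_def of_nat_diff) linarith
  then have "(real n - 1) * (\<theta> + 2) \<le> 0" using tight by (simp add: algebra_simps)
  then show "\<theta> \<le> -2" using n1 by (simp add: mult_le_0_iff)
  assume "\<theta> = -2" and v: "v \<in> V"
  then have k: "b 0 = 2 * (n - 1)" using tight \<open>n > 0\<close> by (simp add: of_nat_diff)
  have two: "clique (N u - R) \<and> card (N u - R) = n - 1" if "clique R" "card R = n" "u \<in> R" for R u
    using nbhd[OF that] k by simp
  have "\<exists>R. clique R \<and> card R = n \<and> v \<in> R"
  proof (rule connected_induct[OF _ v])
    show "u \<in> V" using u Q by (auto simp: clique_def)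
    show "\<exists>R. clique R \<and> card R = n \<and> u \<in> R" using Q u n_def by blast
    fix w z assume "w \<in> V" "\<exists>R. clique R \<and> card R = n \<and> w \<in> R" and z: "z \<in> N w"
    then obtain R where R: "clique R" "card R = n" "w \<in> R" by blast
    show "\<exists>R. clique R \<and> card R = n \<and> z \<in> R"
    proof (cases "z \<in> R")
      case False
      have "clique (insert w (N w - R))"
        using two[OF R] \<open>w \<in> V\<close> by (intro clique_insert) auto
      moreover have "card (insert w (N w - R)) = n"
        using two[OF R] finite_neighbours R(3) \<open>n > 0\<close> by simp
      ultimately show ?thesis using z False by blast
    qed (use R in blast)
  qed
  then obtain R where R: "clique R" "card R = n" "v \<in> R" by blast
  have "N v = (N v \<inter> R) \<union> (N v - R)" by blast
  moreover have "clique (N v \<inter> R)" using R(1) by (auto simp: clique_def)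
  ultimately show "\<exists>A B. N v = A \<union> B \<and> clique A \<and> clique B" using two[OF R] by blast
qed

section \<open>Claw-freeness and colour classes\<close>

lemma coclique_in_two_cliques:
  assumes "N v = A \<union> B" "clique A" "clique B" "coclique I" "I \<subseteq> N v"
  shows "card I \<le> 2"
proof -
  have "I = (A \<inter> I) \<union> (B \<inter> I)" using assms by blast
  then have "card I \<le> card (A \<inter> I) + card (B \<inter> I)" by (metis card_Un_le)
  then show ?thesis
    using card_clique_Int_coclique_le_1[OF assms(2,4)] card_clique_Int_coclique_le_1[OF assms(3,4)]
    by simp
qed

text \<open>
  Count the pairs of a neighbour \<open>v\<close> of \<open>x\<close> and a vertex \<open>y \<in> I\<close> at distance 2 from \<open>x\<close> that is
  adjacent to \<open>v\<close>. Each \<open>y\<close> occurs \<open>c 2\<close> times. Each \<open>v\<close> occurs at most once, as \<open>x\<close> is already one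
  of the at most two neighbours of \<open>v\<close> in \<open>I\<close>.
\<close>

lemma claw_free_distance_2:
  assumes claw_free: "\<And>v J. v \<in> V \<Longrightarrow> coclique J \<Longrightarrow> J \<subseteq> N v \<Longrightarrow> card J \<le> 2"
    and I: "coclique I" and x: "x \<in> I"
  shows "card {y \<in> I. \<delta> x y = 2} \<le> valency / c 2"
proof -
  define Y where "Y = {y \<in> I. \<delta> x y = 2}"
  have xV: "x \<in> V" and YV: "Y \<subseteq> V" using I x by (auto simp: coclique_def Y_def)
  have finY: "finite Y" using finite_coclique[OF I] by (simp add: Y_def)
  have xY: "x \<notin> Y" using dist_eq_0_iff[OF xV xV] by (auto simp: Y_def)
  have below: "card {v \<in> N x. y \<in> N v} = c 2" if y: "y \<in> Y" for y
  proof -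
    have yV: "y \<in> V" and d: "\<delta> x y = 2" using y YV by (auto simp: Y_def)
    have "v \<in> N x \<longleftrightarrow> \<delta> x v + 1 = \<delta> x y" if "v \<in> N y" for v
    proof -
      have "v \<in> V" using that neighbours_subset by blast
      then have "\<delta> x v = 1 \<longleftrightarrow> v \<in> N x" unfolding neighbours_iff by (rule dist_eq_1_iff[OF xV])
      then show ?thesis using d by auto
    qed
    then have "{v \<in> N x. y \<in> N v} = {v \<in> N y. \<delta> x v + 1 = \<delta> x y}"
      using neighbours_commute by blast
    then show ?thesis using intersection_numbers(1)[OF xV yV] d by simp
  qed
  have above: "card {y \<in> Y. y \<in> N v} \<le> 1" if v: "v \<in> N x" for v
  proof -
    let ?J = "insert x {y \<in> Y. y \<in> N v}"
    have "coclique ?J" using I x by (auto simp: coclique_def Y_def)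
    moreover have "?J \<subseteq> N v" using v neighbours_commute by auto
    ultimately have "card ?J \<le> 2" using claw_free v neighbours_subset by blast
    then show ?thesis using xY finY by simp
  qed
  have "card Y * c 2 = (\<Sum>v\<in>N x. card {y \<in> Y. y \<in> N v})"
  proof -
    have "(\<Sum>v\<in>N x. card {y \<in> Y. y \<in> N v}) = (\<Sum>y\<in>Y. c 2)"
      by (rule sum_multicount_gen) (use below finY finite_neighbours in auto)
    then show ?thesis by simp
  qed
  also have "\<dots> \<le> (\<Sum>v\<in>N x. 1)" by (intro sum_mono above)
  also have "\<dots> = b 0" by (simp add: card_neighbours[OF xV])
  finally have le: "card Y * c 2 \<le> b 0" .
  show ?thesis
  proof (cases "Y = {}")
    case False
    then have "c 2 > 0"
      using sphere_empty_if_c_eq_0[of 1 x] xV YV by (auto simp: Y_def numeral_2_eq_2)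
    then show ?thesis using le unfolding Y_def[symmetric]
      by (simp add: field_simps flip: of_nat_mult)
  qed (simp add: Y_def[symmetric])
qed

end

theorem theorem5p1:
  fixes X Xcore :: "'a pair_pre_digraph"
    and b c :: "nat \<Rightarrow> nat"
    and d k :: nat
    and \<theta>\<^sub>d :: real
  assumes "distance_regular X b c"
    and "graph_diameter X = d"
    and "d > 1"
    and "k = b 0"
    and "\<theta>\<^sub>d = least_graph_eigenvalue X"
    and "is_core_of Xcore X"
    and "is_complete_graph Xcore"
  shows "\<theta>\<^sub>d \<le> -2 \<and>
    (\<theta>\<^sub>d = -2 \<longrightarrow>
      (\<forall>u v \<phi>. (u, v) \<in> parcs X \<longrightarrow> graph_hom X Xcore \<phi> \<longrightarrow>
         card {w \<in> neighbours X v. w \<noteq> u \<and> \<phi> w = \<phi> u} \<le> 1) \<and>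
      (\<forall>f :: 'a \<Rightarrow> 'c. proper_colouring X f \<longrightarrow>
         (\<forall>x \<in> pverts X.
            real (card {y \<in> pverts X. f y = f x \<and> graph_dist X x y = 2}) \<le> real k / real (c 2))))"
proof -
  interpret distance_regular_graph X b c
    using assms(1) unfolding distance_regular_def
    by (intro distance_regular_graph.intro connected_pair_graph.intro
        connected_pair_graph_axioms.intro distance_regular_graph_axioms.intro) auto
  let ?Q = "pverts Xcore"
  have core: "pverts Xcore \<subseteq> V" "parcs Xcore \<subseteq> E" "pair_graph Xcore"
    using assms(6) by (auto simp: is_core_of_def is_graph_core_def subgraph_def)
  interpret core: pair_graph Xcore by (rule core(3))
  have complete: "parcs Xcore = {(u, v). u \<in> ?Q \<and> v \<in> ?Q \<and> u \<noteq> v}"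
    using assms(7) by (auto simp: is_complete_graph_def complete_digraph_def)
  obtain \<phi> where hom: "graph_hom X Xcore \<phi>" using assms(6) by (auto simp: is_core_of_def)
  have proper: "\<psi> u \<noteq> \<psi> v" if "graph_hom X Xcore \<psi>" "(u, v) \<in> E" for \<psi> u v
    using that unfolding graph_hom_def complete by blast
  have Q: "clique ?Q" using core(1,2) by (auto simp: clique_def complete)
  have Qne: "?Q \<noteq> {}" using hom verts_nonempty by (auto simp: graph_hom_def)
  (* A complete graph has diameter at most 1. *)
  have "?Q \<noteq> V"
  proof
    assume QV: "?Q = V"
    let ?D = "{\<delta> u v | u v. u \<in> V \<and> v \<in> V}"
    have "?D = (\<lambda>(u, v). \<delta> u v) ` (V \<times> V)" by auto
    then have "finite ?D" "?D \<noteq> {}" using pair_finite_verts verts_nonempty by auto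
    then have "d \<in> ?D" using assms(2) Max_in unfolding graph_diameter_def by blast
    then obtain u v where uv: "u \<in> V" "v \<in> V" "\<delta> u v = d" by blast
    then have "\<delta> u v \<le> 1"
      using Q dist_eq_0_iff[OF uv(1,2)] dist_eq_1_iff[OF uv(1,2)] unfolding QV clique_def
      by (cases "u = v") auto
    then show False using uv assms(3) by simp
  qed
  note main = clique_attaining_chromatic_number[OF Q Qne this proper[OF hom] _ core.pair_finite_verts refl assms(5)]
  have \<phi>Q: "\<phi> ` V \<subseteq> ?Q" using hom by (simp add: graph_hom_def)
  have claw_free: "card J \<le> 2" if "\<theta>\<^sub>d = -2" "v \<in> V" "coclique J" "J \<subseteq> N v" for v J
    using main(2)[OF _ \<phi>Q that(1,2)] coclique_in_two_cliques that(3,4) by blast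
  have "\<theta>\<^sub>d \<le> -2" by (rule main(1)[OF _ \<phi>Q])
  moreover have "card {w \<in> N v. w \<noteq> u \<and> \<psi> w = \<psi> u} \<le> 1"
    if "\<theta>\<^sub>d = -2" and uv: "(u, v) \<in> E" and \<psi>: "graph_hom X Xcore \<psi>" for u v \<psi>
  proof -
    let ?J = "{w \<in> N v. \<psi> w = \<psi> u}"
    have "coclique ?J" using proper[OF \<psi>] neighbours_subset unfolding coclique_def by fastforce
    then have "card ?J \<le> 2" using claw_free that(1) in_arcsD2[OF uv] by blast
    moreover have "u \<in> ?J" using uv neighbours_commute by (simp add: neighbours_iff)
    moreover have "{w \<in> N v. w \<noteq> u \<and> \<psi> w = \<psi> u} = ?J - {u}" by blast
    ultimately show ?thesis by simp
  qed
  moreover have "real (card {y \<in> V. f y = f x \<and> \<delta> x y = 2}) \<le> real k / real (c 2)"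
    if "\<theta>\<^sub>d = -2" and f: "proper_colouring X f" and x: "x \<in> V" for f :: "'a \<Rightarrow> 'c" and x
  proof -
    let ?I = "{y \<in> V. f y = f x}"
    have "coclique ?I" using f unfolding coclique_def proper_colouring_def by fastforce
    moreover have "x \<in> ?I" using x by simp
    ultimately have "real (card {y \<in> ?I. \<delta> x y = 2}) \<le> valency / c 2"
      using claw_free_distance_2 claw_free[OF that(1)] by blast
    moreover have "{y \<in> ?I. \<delta> x y = 2} = {y \<in> V. f y = f x \<and> \<delta> x y = 2}" by blast
    ultimately show ?thesis using assms(4) by simp
  qed
  ultimately show ?thesis by blast
qed

end
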